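(* Let $1\le m\le n$ and $\pi\in\mathfrak S_{m,n}$. The generic pipe dream polynomial $G^\beta_\pi$ is independent of the hybridization $\beta\in\{\mathsf w,\mathsf e\}^m$.
   Context: Fix $1\le m\le n$. $\mathfrak S_{m,n}$ is the set of injective maps $\{1,\dots,m\}\to\{1,\dots,n\}$. A hybridization is $\beta=(\beta_1,\dots,\beta_m)\in\{\mathsf w,\mathsf e\}^m$; row $i$ (counted from the top) of an $m\times n$ grid is of type $\beta_i$. A hybrid generic pipe dream of type $\beta$ is a filling of the grid (columns $1,\dots,n$ left to right) with tiles, each tile being a unit square in which pipes join midpoints of edges. Allowed tiles in rows of type $\mathsf w$: blank (no pipe); straight tiles: horizontal (West–East), vertical (South–North), cross (both, crossing); elbow tiles: single elbow West–North, single elbow South–East, double elbow (both West–North and South–East). In rows of type $\mathsf e$: blank; the same three straight tiles; elbow tiles: single elbow East–North, single elbow South–West, double elbow (both). Conditions: no pipe starts or ends in the interior of the grid; in each row of type $\mathsf w$ a pipe enters through the West boundary edge and none exits through the East boundary edge; in each row of type $\mathsf e$ a pipe enters through the East boundary edge and none exits through the West; no pipe crosses the South boundary. (Pipes may cross more than once.) Each pipe then exits through the North boundary. Pipes are numbered counterclockwise starting from the northwest corner: the pipes entering from the West are numbered $1,\dots,k$ from top to bottom ($k$ = number of $\mathsf w$ rows), and those entering from the East are numbered $k+1,\dots,m$ from bottom to top; $\varphi(i)$ is the number of the pipe entering in row $i$. The connectivity is the $\pi\in\mathfrak S_{m,n}$ such that pipe numbered $i$ exits the North side in column $\pi(i)$.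 The weight of a pipe dream is the product over its tiles, in $\mathbb Z[x_1,\dots,x_m,y_1,\dots,y_n,A,B]$, of: $A+B$ for elbow tiles; if $\beta_i=\mathsf w$, $B-x_{\varphi(i)}+y_j$ for a blank tile and $A+x_{\varphi(i)}-y_j$ for a straight tile at $(i,j)$; if $\beta_i=\mathsf e$, $A+x_{\varphi(i)}-y_j$ for a blank tile and $B-x_{\varphi(i)}+y_j$ for a straight tile at $(i,j)$. $G^\beta_\pi$ is the sum of the weights of all hybrid generic pipe dreams of type $\beta$ with connectivity $\pi$. *)

theory Defs
  imports Main "HOL-Library.FuncSet" "HOL-Library.Poly_Mapping"
begin

text \<open>
  Integer polynomials are finitely supported maps from monomials (exponent vectors) to
  coefficients, with the convolution product of \<^theory>\<open>HOL-Library.Poly_Mapping\<close>. Infinitely many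
  variables are available, but only \<open>x\<^sub>1, \<dots>, x\<^sub>m, y\<^sub>1, \<dots>, y\<^sub>n, A, B\<close> occur in the polynomials below.
\<close>

datatype indet = Ind_x nat | Ind_y nat | Ind_A | Ind_B

type_synonym int_mpoly = "(indet \<Rightarrow>\<^sub>0 nat) \<Rightarrow>\<^sub>0 int"

definition Var :: "indet \<Rightarrow> int_mpoly" where
  "Var v = Poly_Mapping.single (Poly_Mapping.single v 1) 1"

definition injections :: "nat \<Rightarrow> nat \<Rightarrow> (nat \<Rightarrow> nat) set" where
  "injections m n = {\<pi> \<in> {1..m} \<rightarrow>\<^sub>E {1..n}. inj_on \<pi> {1..m}}"

text \<open>
  A hybridization is a function \<open>\<beta> :: nat \<Rightarrow> row_type\<close>, of which only the values on \<open>{1..m}\<close> are used.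
\<close>

datatype row_type = Type_w | Type_e

datatype side = North | South | East | West

datatype tile =
    Blank | Horizontal | Vertical | Cross
  | Elbow_WN | Elbow_SE | Elbow_WN_SE
  | Elbow_EN | Elbow_SW | Elbow_EN_SW

text \<open>Each segment of pipe in a tile is given by the two sides whose midpoints it joins.\<close>

fun segments :: "tile \<Rightarrow> side set set" where
  "segments Blank = {}"
| "segments Horizontal = {{West, East}}"
| "segments Vertical = {{South, North}}"
| "segments Cross = {{West, East}, {South, North}}"
| "segments Elbow_WN = {{West, North}}"
| "segments Elbow_SE = {{South, East}}"
| "segments Elbow_WN_SE = {{West, North}, {South, East}}"
| "segments Elbow_EN = {{East, North}}"
| "segments Elbow_SW = {{South, West}}"
| "segments Elbow_EN_SW = {{East, North}, {South, West}}"

definition meets :: "tile \<Rightarrow> side \<Rightarrow> bool" where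
  "meets t s \<longleftrightarrow> s \<in> \<Union> (segments t)"

definition straight_tiles :: "tile set" where
  "straight_tiles = {Horizontal, Vertical, Cross}"

fun elbow_tiles :: "row_type \<Rightarrow> tile set" where
  "elbow_tiles Type_w = {Elbow_WN, Elbow_SE, Elbow_WN_SE}"
| "elbow_tiles Type_e = {Elbow_EN, Elbow_SW, Elbow_EN_SW}"

definition allowed_tiles :: "row_type \<Rightarrow> tile set" where
  "allowed_tiles b = {Blank} \<union> straight_tiles \<union> elbow_tiles b"

text \<open>
  Cell \<open>(i, j)\<close> lies in row \<open>i\<close> from the top and column \<open>j\<close> from the left. The two equivalences
  between adjacent tiles say that no pipe starts or ends in the interior of the grid.
\<close>

definition pipe_dreams :: "nat \<Rightarrow> nat \<Rightarrow> (nat \<Rightarrow> row_type) \<Rightarrow> (nat \<times> nat \<Rightarrow> tile) set" where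
  "pipe_dreams m n \<beta> =
    {D \<in> (\<Pi>\<^sub>E (i, j) \<in> {1..m} \<times> {1..n}. allowed_tiles (\<beta> i)).
      (\<forall>i\<in>{1..m}. \<forall>j\<in>{1..<n}. meets (D (i, j)) East \<longleftrightarrow> meets (D (i, j + 1)) West) \<and>
      (\<forall>i\<in>{1..<m}. \<forall>j\<in>{1..n}. meets (D (i, j)) South \<longleftrightarrow> meets (D (i + 1, j)) North) \<and>
      (\<forall>i\<in>{1..m}. \<beta> i = Type_w \<longrightarrow> meets (D (i, 1)) West \<and> \<not> meets (D (i, n)) East) \<and>
      (\<forall>i\<in>{1..m}. \<beta> i = Type_e \<longrightarrow> meets (D (i, n)) East \<and> \<not> meets (D (i, 1)) West) \<and>
      (\<forall>j\<in>{1..n}. \<not> meets (D (m, j)) South)}"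

text \<open>
  The number \<open>\<phi>(i)\<close> of the pipe entering in row \<open>i\<close>: pipes entering from the West come first, from
  top to bottom, followed by those entering from the East, from bottom to top.
\<close>

definition pipe_number :: "nat \<Rightarrow> (nat \<Rightarrow> row_type) \<Rightarrow> nat \<Rightarrow> nat" where
  "pipe_number m \<beta> i =
    (case \<beta> i of
       Type_w \<Rightarrow> card {r \<in> {1..i}. \<beta> r = Type_w}
     | Type_e \<Rightarrow> card {r \<in> {1..m}. \<beta> r = Type_w} + card {r \<in> {i..m}. \<beta> r = Type_e})"

text \<open>
  \<open>HEdge i j\<close> is the horizontal unit edge in column \<open>j\<close> between rows \<open>i\<close> and \<open>i + 1\<close>, and
  \<open>VEdge i j\<close> is the vertical unit edge in row \<open>i\<close> between columns \<open>j\<close> and \<open>j + 1\<close>; the index \<open>0\<close>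
  thus gives the North and West boundary respectively.
\<close>

datatype grid_edge = HEdge nat nat | VEdge nat nat

fun cell_edge :: "nat \<Rightarrow> nat \<Rightarrow> side \<Rightarrow> grid_edge" where
  "cell_edge i j North = HEdge (i - 1) j"
| "cell_edge i j South = HEdge i j"
| "cell_edge i j East = VEdge i j"
| "cell_edge i j West = VEdge i (j - 1)"

definition joined :: "nat \<Rightarrow> nat \<Rightarrow> (nat \<times> nat \<Rightarrow> tile) \<Rightarrow> (grid_edge \<times> grid_edge) set" where
  "joined m n D =
    {(cell_edge i j s, cell_edge i j s') | i j s s'.
      i \<in> {1..m} \<and> j \<in> {1..n} \<and> {s, s'} \<in> segments (D (i, j))}"

fun entry_edge :: "nat \<Rightarrow> row_type \<Rightarrow> nat \<Rightarrow> grid_edge" where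
  "entry_edge n Type_w i = VEdge i 0"
| "entry_edge n Type_e i = VEdge i n"

definition has_connectivity ::
  "nat \<Rightarrow> nat \<Rightarrow> (nat \<Rightarrow> row_type) \<Rightarrow> (nat \<times> nat \<Rightarrow> tile) \<Rightarrow> (nat \<Rightarrow> nat) \<Rightarrow> bool" where
  "has_connectivity m n \<beta> D \<pi> \<longleftrightarrow>
    (\<forall>i\<in>{1..m}. (entry_edge n (\<beta> i) i, HEdge 0 (\<pi> (pipe_number m \<beta> i))) \<in> (joined m n D)\<^sup>*)"

definition tile_weight ::
  "nat \<Rightarrow> (nat \<Rightarrow> row_type) \<Rightarrow> nat \<Rightarrow> nat \<Rightarrow> tile \<Rightarrow> int_mpoly" where
  "tile_weight m \<beta> i j t =
    (let x = Var (Ind_x (pipe_number m \<beta> i)); y = Var (Ind_y j); A = Var Ind_A; B = Var Ind_B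
     in if t = Blank then
          (case \<beta> i of Type_w \<Rightarrow> B - x + y | Type_e \<Rightarrow> A + x - y)
        else if t \<in> straight_tiles then
          (case \<beta> i of Type_w \<Rightarrow> A + x - y | Type_e \<Rightarrow> B - x + y)
        else A + B)"

definition weight ::
  "nat \<Rightarrow> nat \<Rightarrow> (nat \<Rightarrow> row_type) \<Rightarrow> (nat \<times> nat \<Rightarrow> tile) \<Rightarrow> int_mpoly" where
  "weight m n \<beta> D = (\<Prod>i\<in>{1..m}. \<Prod>j\<in>{1..n}. tile_weight m \<beta> i j (D (i, j)))"

definition generic_poly :: "nat \<Rightarrow> nat \<Rightarrow> (nat \<Rightarrow> row_type) \<Rightarrow> (nat \<Rightarrow> nat) \<Rightarrow> int_mpoly" where
  "generic_poly m n \<beta> \<pi> =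
    (\<Sum>D | D \<in> pipe_dreams m n \<beta> \<and> has_connectivity m n \<beta> D \<pi>. weight m n \<beta> D)"

lemma finite_pipe_dreams: "finite (pipe_dreams m n \<beta>)"
proof -
  have "finite (\<Pi>\<^sub>E (i, j) \<in> {1..m} \<times> {1..n}. allowed_tiles (\<beta> i))"
  proof (rule finite_PiE)
    fix c assume "c \<in> {1..m} \<times> {1..n}"
    show "finite (case c of (i, j) \<Rightarrow> allowed_tiles (\<beta> i))"
      by (cases c; cases "\<beta> (fst c)") (auto simp: allowed_tiles_def straight_tiles_def)
  qed simp
  then show ?thesis
    unfolding pipe_dreams_def by simp
qed

end

theory Submission
  imports Defs "HOL-Library.Countable"
begin

text \<open>
  Label every edge of the grid by the number of the pipe through it, or by \<open>0\<close>. Then \<open>G\<close> becomes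
  a matrix element of a product of row transfer matrices, and each tile is a vertex of the rational
  graded \<open>R\<close>-matrix, in both row types. By the Yang--Baxter equation, an adjacent pair of rows of
  type \<open>e\<close> and \<open>w\<close> may be interchanged together with their variables, up to the nonzero factor
  \<open>A + B + x\<^sub>p - x\<^sub>q\<close>, which is cancelled. A row of type \<open>e\<close> that has been moved to the bottom may
  be changed to type \<open>w\<close>, because its pipe has a single elbow and the two types give the same
  weight. Both moves are compatible with the numbering of the pipes.
\<close>

section \<open>Cancellation of the crossing weight\<close>

text \<open>Connectivity is global and pipes may cross repeatedly, so knowing which edges are
  occupied does not determine it; with a pipe number on every edge it becomes a condition on the top
  boundary. One family of vertices covers both row types because blank plus straight always equals
  \<open>A + B\<close>, the elbow weight. A row of type e is this vertex read from East to West.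
  Thus an e row and a w row are oppositely directed lines, and the weight of their crossing is the
  sum of their straight weights rather than a difference. An exchange of rows moves the pipe numbers
  with the rows, and only the combined effect of sinking a row and changing its type restores a
  numbering of the prescribed form. Passing between labelled grids and pipe dreams needs the absence
  of closed pipes, since a closed pipe could carry any label. It follows from the direction of
  travel: along a pipe the row never moves down, and within a row the motion is always away from the
  entry side.\<close>

text \<open>The order serves only to make \<^typ>\<open>int_mpoly\<close> an integral domain.\<close>

instance indet :: countable
  by countable_datatype

instantiation indet :: linorder
begin

definition "v \<le> w \<longleftrightarrow> to_nat v \<le> to_nat (w :: indet)"
definition "v < w \<longleftrightarrow> to_nat v < to_nat (w :: indet)"

instance
  by standard (auto simp: less_eq_indet_def less_indet_def)

end

lemma lookup_Var: "Poly_Mapping.lookup (Var v) (Poly_Mapping.single w 1) = (if v = w then 1 else 0)"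
proof -
  have "Poly_Mapping.single v (1 :: nat) = Poly_Mapping.single w 1 \<longleftrightarrow> v = w"
    by (metis lookup_single_eq lookup_single_not_eq zero_neq_one)
  then show ?thesis
    by (auto simp: Var_def lookup_single when_def)
qed

text \<open>The variable \<open>A\<close> has coefficient 1 and nothing cancels it. This includes
  the case \<open>k = l\<close>, in which the two \<open>x\<close> terms cancel.\<close>

lemma crossing_weight_nonzero: "(Var Ind_A + Var (Ind_x k)) + (Var Ind_B - Var (Ind_x l)) \<noteq> (0 :: int_mpoly)"
proof
  assume "(Var Ind_A + Var (Ind_x k)) + (Var Ind_B - Var (Ind_x l)) = 0"
  then have "Poly_Mapping.lookup ((Var Ind_A + Var (Ind_x k)) + (Var Ind_B - Var (Ind_x l)))
      (Poly_Mapping.single Ind_A 1) = 0"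
    by simp
  then show False
    by (simp only: lookup_add lookup_minus lookup_Var) simp
qed

section \<open>Products of matrices indexed by a finite set\<close>

type_synonym ('s, 'r) matrix = "'s \<Rightarrow> 's \<Rightarrow> 'r"

fun mprod :: "'s set \<Rightarrow> ('s, 'r::comm_ring_1) matrix list \<Rightarrow> ('s, 'r) matrix" where
  "mprod K [] a c = of_bool (a = c)"
| "mprod K (M # Ms) a c = (\<Sum>d\<in>K. M a d * mprod K Ms d c)"

lemma sum_of_bool_mult [simp]:
  assumes "finite K"
  shows "(\<Sum>d\<in>K. of_bool (d = a) * f d) = (if a \<in> K then f a else (0::'r::comm_ring_1))"
    and "(\<Sum>d\<in>K. of_bool (a = d) * f d) = (if a \<in> K then f a else 0)"
    and "(\<Sum>d\<in>K. f d * of_bool (d = a)) = (if a \<in> K then f a else 0)"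
    and "(\<Sum>d\<in>K. f d * of_bool (a = d)) = (if a \<in> K then f a else 0)"
proof -
  have *: "of_bool (d = a) * f d = (if d = a then f d else 0)"
    "of_bool (a = d) * f d = (if d = a then f d else 0)"
    "f d * of_bool (d = a) = (if d = a then f d else 0)"
    "f d * of_bool (a = d) = (if d = a then f d else 0)" for d
    by auto
  show "(\<Sum>d\<in>K. of_bool (d = a) * f d) = (if a \<in> K then f a else (0::'r::comm_ring_1))"
    "(\<Sum>d\<in>K. of_bool (a = d) * f d) = (if a \<in> K then f a else 0)"
    "(\<Sum>d\<in>K. f d * of_bool (d = a)) = (if a \<in> K then f a else 0)"
    "(\<Sum>d\<in>K. f d * of_bool (a = d)) = (if a \<in> K then f a else 0)"
    unfolding * using assms by simp_all
qed

lemma mprod_snoc: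
  assumes "finite K" "a \<in> K" "c \<in> K"
  shows "mprod K (Ms @ [M]) a c = (\<Sum>d\<in>K. mprod K Ms a d * M d c)"
  using assms(2)
proof (induction Ms arbitrary: a)
  case Nil
  then show ?case using assms by simp
next
  case (Cons N Ms)
  have "mprod K ((N # Ms) @ [M]) a c = (\<Sum>d\<in>K. \<Sum>e\<in>K. N a d * mprod K Ms d e * M e c)"
    by (simp add: Cons.IH sum_distrib_left mult.assoc cong: sum.cong)
  also have "\<dots> = (\<Sum>e\<in>K. \<Sum>d\<in>K. N a d * mprod K Ms d e * M e c)"
    by (rule sum.swap)
  finally show ?case
    by (simp add: sum_distrib_right)
qed

text \<open>The train argument: \<open>R\<close> passes through the product one factor at a time,
  turning each \<open>M\<close> into its \<open>N\<close>.\<close>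

lemma mprod_intertwine:
  assumes "finite K"
    and "list_all2 (\<lambda>M N. \<forall>a\<in>K. \<forall>c\<in>K. (\<Sum>d\<in>K. R a d * M d c) = (\<Sum>d\<in>K. N a d * R d c)) Ms Ns"
    and "a \<in> K" "c \<in> K"
  shows "(\<Sum>d\<in>K. R a d * mprod K Ms d c) = (\<Sum>d\<in>K. mprod K Ns a d * R d c)"
  using assms(2,3)
proof (induction arbitrary: a rule: list_all2_induct)
  case Nil
  then show ?case using assms by simp
next
  case (Cons M Ms N Ns)
  have "(\<Sum>d\<in>K. R a d * mprod K (M # Ms) d c) = (\<Sum>d\<in>K. \<Sum>e\<in>K. R a d * M d e * mprod K Ms e c)"
    by (simp add: sum_distrib_left mult.assoc)
  also have "\<dots> = (\<Sum>e\<in>K. (\<Sum>d\<in>K. R a d * M d e) * mprod K Ms e c)"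
    by (subst sum.swap) (simp add: sum_distrib_right)
  also have "\<dots> = (\<Sum>e\<in>K. (\<Sum>d\<in>K. N a d * R d e) * mprod K Ms e c)"
    using Cons by (intro sum.cong) auto
  also have "\<dots> = (\<Sum>d\<in>K. \<Sum>e\<in>K. N a d * (R d e * mprod K Ms e c))"
    by (subst sum.swap) (simp add: sum_distrib_right mult.assoc)
  also have "\<dots> = (\<Sum>d\<in>K. N a d * (\<Sum>e\<in>K. mprod K Ns d e * R e c))"
    using Cons by (intro sum.cong) (auto simp: sum_distrib_left[symmetric])
  also have "\<dots> = (\<Sum>e\<in>K. \<Sum>d\<in>K. N a d * mprod K Ns d e * R e c)"
    by (subst sum.swap) (simp add: sum_distrib_left mult.assoc)
  finally show ?case
    by (simp add: sum_distrib_right)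
qed

text \<open>No nonzero entry leads out of \<open>K'\<close>, so a path starting in \<open>K'\<close>
  never leaves it.\<close>

lemma mprod_restrict_source:
  assumes "finite K" "K' \<subseteq> K"
    and "\<And>M a c. M \<in> set Ms \<Longrightarrow> a \<in> K' \<Longrightarrow> c \<in> K - K' \<Longrightarrow> M a c = 0"
    and "a \<in> K'"
  shows "mprod K Ms a c = mprod K' Ms a c"
  using assms(3,4)
proof (induction Ms arbitrary: a)
  case (Cons M Ms)
  have "mprod K (M # Ms) a c = (\<Sum>d\<in>K'. M a d * mprod K Ms d c)"
    using assms(1,2) Cons.prems(1)[of M] Cons.prems(2)
    by (auto intro!: sum.mono_neutral_right)
  also have "\<dots> = mprod K' (M # Ms) a c"
    using Cons by simp
  finally show ?case .
qed simp

text \<open>No nonzero entry leads into \<open>K'\<close> from outside, so a path ending in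
  \<open>K'\<close> lies in it throughout. This is the form for e rows, whose matrices are
  multiplied against the direction of travel.\<close>

lemma mprod_restrict_target:
  assumes "finite K" "K' \<subseteq> K"
    and "\<And>M a c. M \<in> set Ms \<Longrightarrow> a \<in> K - K' \<Longrightarrow> c \<in> K' \<Longrightarrow> M a c = 0"
    and "a \<in> K'" "c \<in> K'"
  shows "mprod K Ms a c = mprod K' Ms a c"
proof -
  have "(a \<in> K - K' \<longrightarrow> mprod K Ms a c = 0) \<and> (a \<in> K' \<longrightarrow> mprod K Ms a c = mprod K' Ms a c)"
    using assms(3)
  proof (induction Ms arbitrary: a)
    case Nil
    then show ?case using assms(5) by auto
  next
    case (Cons M Ms)
    have IH: "mprod K Ms d c = (if d \<in> K' then mprod K' Ms d c else 0)" if "d \<in> K" for d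
      using Cons.IH[of d] Cons.prems that by (metis DiffI list.set_intros(2))
    have "mprod K (M # Ms) a c = (\<Sum>d\<in>K'. M a d * mprod K' Ms d c)"
      unfolding mprod.simps using assms(1,2) by (intro sum.mono_neutral_cong_right) (auto simp: IH)
    moreover have "M a d = 0" if "a \<in> K - K'" "d \<in> K'" for d
      using Cons.prems[of M a d] that by simp
    ultimately show ?case
      by simp
  qed
  then show ?thesis
    using assms(4) by simp
qed

lemma mprod_reindex:
  assumes "bij_betw \<theta> K K'" "a \<in> K" "c \<in> K"
    and "list_all2 (\<lambda>M N. \<forall>a\<in>K. \<forall>c\<in>K. M a c = N (\<theta> a) (\<theta> c)) Ms Ns"
  shows "mprod K Ms a c = mprod K' Ns (\<theta> a) (\<theta> c)"
  using assms(4,2)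
proof (induction arbitrary: a rule: list_all2_induct)
  case Nil
  then show ?case
    using assms by (auto simp: bij_betw_def inj_on_def)
next
  case (Cons M Ms N Ns)
  have "mprod K (M # Ms) a c = (\<Sum>d\<in>K. N (\<theta> a) (\<theta> d) * mprod K' Ns (\<theta> d) (\<theta> c))"
    using Cons assms(3) by (simp cong: sum.cong)
  also have "\<dots> = mprod K' (N # Ns) (\<theta> a) (\<theta> c)"
    using sum.reindex_bij_betw[OF assms(1), of "\<lambda>d. N (\<theta> a) d * mprod K' Ns d (\<theta> c)"] by simp
  finally show ?case .
qed

lemma sum_PiE_insert:
  assumes "x \<notin> A"
  shows "(\<Sum>v\<in>PiE (insert x A) B. f v) = (\<Sum>k\<in>B x. \<Sum>v\<in>PiE A B. f (v(x := k)))"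
proof -
  have "(\<Sum>v\<in>PiE (insert x A) B. f v) = (\<Sum>p\<in>B x \<times> PiE A B. f ((snd p)(x := fst p)))"
    unfolding PiE_insert_eq
    using inj_combinator[OF assms, of B]
    by (subst sum.reindex) (auto simp: case_prod_unfold)
  then show ?thesis
    by (simp add: sum.cartesian_product case_prod_unfold)
qed

text \<open>The expansion of a matrix product over paths. It serves in both directions of the grid:
  paths of row states from top to bottom, and paths of labels along one row.\<close>

lemma mprod_eq_sum_PiE:
  assumes "finite K" "a \<in> K" "c \<in> K"
  shows "mprod K Ms a c = (\<Sum>v | v \<in> {0..length Ms} \<rightarrow>\<^sub>E K \<and> v 0 = a \<and> v (length Ms) = c.
           \<Prod>j<length Ms. (Ms ! j) (v j) (v (Suc j)))"
  using assms(3)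
proof (induction Ms arbitrary: c rule: rev_induct)
  case Nil
  have *: "{v. v \<in> {0} \<rightarrow>\<^sub>E K \<and> v 0 = a \<and> v 0 = c} = (if a = c then {\<lambda>x\<in>{0}. a} else {})"
    using assms by (auto simp: PiE_iff fun_eq_iff extensional_def)
  show ?case by (simp add: * assms)
next
  case (snoc M Ms)
  let ?n = "length Ms"
  let ?F = "\<lambda>v. \<Prod>j<?n. (Ms ! j) (v j) (v (Suc j))"
  have fin: "finite ({0..?n} \<rightarrow>\<^sub>E K)"
    using assms by (intro finite_PiE) auto
  have "(\<Sum>v | v \<in> {0..Suc ?n} \<rightarrow>\<^sub>E K \<and> v 0 = a \<and> v (Suc ?n) = c.
           \<Prod>j<Suc ?n. ((Ms @ [M]) ! j) (v j) (v (Suc j)))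
    = (\<Sum>v\<in>{0..Suc ?n} \<rightarrow>\<^sub>E K. if v 0 = a \<and> v (Suc ?n) = c then ?F v * M (v ?n) (v (Suc ?n)) else 0)"
    by (subst sum.inter_filter[symmetric])
      (use assms in \<open>auto intro!: sum.cong finite_PiE prod.cong simp: nth_append\<close>)
  also have "\<dots> = (\<Sum>k\<in>K. \<Sum>v\<in>{0..?n} \<rightarrow>\<^sub>E K. if v 0 = a \<and> k = c then ?F v * M (v ?n) k else 0)"
    unfolding atLeast0_atMost_Suc by (subst sum_PiE_insert) (auto intro!: sum.cong)
  also have "\<dots> = (\<Sum>v\<in>{0..?n} \<rightarrow>\<^sub>E K. \<Sum>k\<in>K. if k = c then (if v 0 = a then ?F v * M (v ?n) k else 0) else 0)"
    by (subst sum.swap) (auto intro!: sum.cong)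
  also have "\<dots> = (\<Sum>v\<in>{0..?n} \<rightarrow>\<^sub>E K. if v 0 = a then ?F v * M (v ?n) c else 0)"
    using assms snoc.prems by simp
  \<comment> \<open>The truncated paths are sorted by their last state \<open>d\<close>, so that the
    induction hypothesis applies to each class.\<close>
  also have "\<dots> = (\<Sum>v\<in>{0..?n} \<rightarrow>\<^sub>E K. \<Sum>d\<in>K. if v ?n = d then (if v 0 = a then ?F v * M d c else 0) else 0)"
    using assms by (intro sum.cong) (auto simp: PiE_iff)
  also have "\<dots> = (\<Sum>d\<in>K. (\<Sum>v\<in>{0..?n} \<rightarrow>\<^sub>E K. if v 0 = a \<and> v ?n = d then ?F v else 0) * M d c)"
    by (subst sum.swap) (auto simp: sum_distrib_right intro!: sum.cong)
  also have "\<dots> = (\<Sum>d\<in>K. mprod K Ms a d * M d c)"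
    using snoc.IH by (intro sum.cong) (auto simp: sum.inter_filter[OF fin, symmetric])
  also have "\<dots> = mprod K (Ms @ [M]) a c"
    using mprod_snoc assms snoc.prems by metis
  finally show ?case by simp
qed

lemma mprod_upt:
  assumes "finite K" "a \<in> K" "c \<in> K"
  shows "mprod K (map M [1..<Suc l]) a c =
    (\<Sum>v | v \<in> {0..l} \<rightarrow>\<^sub>E K \<and> v 0 = a \<and> v l = c. \<Prod>j\<in>{1..l}. M j (v (j - 1)) (v j))"
  using mprod_eq_sum_PiE[OF assms, of "map M [1..<Suc l]"]
  by (simp add: prod.atLeast1_atMost_eq del: upt_Suc)

section \<open>Vertex weights and the Yang--Baxter equation\<close>

text \<open>
  Two lines labelled \<open>a\<close> and \<open>s\<close> enter a vertex and leave it opposite to their entry with labels \<open>c\<close>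
  and \<open>t\<close>. They either go straight (weight \<open>\<sigma>\<close>) or turn (weight \<open>\<tau>\<close>); the label \<open>0\<close> marks a line
  without pipe. The sign makes the weight of a blank tile equal to \<open>\<tau> - \<sigma>\<close>.
\<close>

definition vertex :: "'r::comm_ring_1 \<Rightarrow> 'r \<Rightarrow> nat \<Rightarrow> nat \<Rightarrow> nat \<Rightarrow> nat \<Rightarrow> 'r" where
  "vertex \<sigma> \<tau> a s c t =
    of_bool (c = a) * of_bool (t = s) * (if a = 0 \<and> s = 0 then - \<sigma> else \<sigma>) +
    of_bool (t = a) * of_bool (c = s) * \<tau>"

lemma vertex_swap: "vertex \<sigma> \<tau> a s c t = vertex \<sigma> \<tau> s a t c"
  by (auto simp: vertex_def)

lemma sum_vertex_left:
  assumes "finite K" "a \<in> K" "s \<in> K"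
  shows "(\<Sum>c\<in>K. vertex \<sigma> \<tau> a s c t * F c) =
    of_bool (t = s) * (if a = 0 \<and> s = 0 then - \<sigma> else \<sigma>) * F a + of_bool (t = a) * \<tau> * F s"
proof -
  have "(\<Sum>c\<in>K. vertex \<sigma> \<tau> a s c t * F c) =
    (\<Sum>c\<in>K. of_bool (c = a) * (of_bool (t = s) * (if a = 0 \<and> s = 0 then - \<sigma> else \<sigma>) * F c)) +
    (\<Sum>c\<in>K. of_bool (c = s) * (of_bool (t = a) * \<tau> * F c))"
    by (simp add: vertex_def algebra_simps sum.distrib)
  then show ?thesis
    using assms by simp
qed

lemma sum_vertex_right:
  assumes "finite K" "a \<in> K" "s \<in> K"
  shows "(\<Sum>t\<in>K. vertex \<sigma> \<tau> a s c t * F t) =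
    of_bool (c = a) * (if a = 0 \<and> s = 0 then - \<sigma> else \<sigma>) * F s + of_bool (c = s) * \<tau> * F a"
  using sum_vertex_left[OF assms(1,3,2), of \<sigma> \<tau> c F]
  by (simp add: vertex_swap[of \<sigma> \<tau> a s c] conj_commute cong: if_cong)

lemma sum_vertex:
  assumes "finite K" "a \<in> K" "s \<in> K"
  shows "(\<Sum>c\<in>K. \<Sum>t\<in>K. vertex \<sigma> \<tau> a s c t * F c t) =
    (if a = 0 \<and> s = 0 then - \<sigma> else \<sigma>) * F a s + \<tau> * F s a"
proof -
  have "(\<Sum>c\<in>K. \<Sum>t\<in>K. vertex \<sigma> \<tau> a s c t * F c t) =
    (\<Sum>t\<in>K. of_bool (t = s) * ((if a = 0 \<and> s = 0 then - \<sigma> else \<sigma>) * F a t)) +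
    (\<Sum>t\<in>K. of_bool (t = a) * (\<tau> * F s t))"
    using assms by (subst sum.swap) (simp only: sum_vertex_left sum.distrib mult.assoc)
  then show ?thesis
    using assms by simp
qed

text \<open>
  The sign attached to two crossing blank lines is determined by the connectivity of the three
  lines, so it factors out of the rational Yang--Baxter equation.
\<close>

lemma yang_baxter:
  assumes "finite K" "p \<in> K" "q \<in> K" "u \<in> K" and "\<sigma>\<^sub>2 = \<sigma>\<^sub>1 + \<sigma>\<^sub>3"
  shows "(\<Sum>d\<in>K. \<Sum>k\<in>K. vertex \<sigma>\<^sub>3 \<tau> q u d k *
        (\<Sum>e\<in>K. vertex \<sigma>\<^sub>2 \<tau> p d e y * vertex \<sigma>\<^sub>1 \<tau> e k x t)) =
    (\<Sum>d\<in>K. \<Sum>k\<in>K. vertex \<sigma>\<^sub>1 \<tau> p u d k *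
        (\<Sum>e\<in>K. vertex \<sigma>\<^sub>2 \<tau> d q x e * vertex \<sigma>\<^sub>3 \<tau> e k y t))"
  (is "?L = ?R")
proof -
  have "?L = (if q = 0 \<and> u = 0 then - \<sigma>\<^sub>3 else \<sigma>\<^sub>3) *
        (\<Sum>e\<in>K. vertex \<sigma>\<^sub>2 \<tau> p q e y * vertex \<sigma>\<^sub>1 \<tau> e u x t) +
      \<tau> * (\<Sum>e\<in>K. vertex \<sigma>\<^sub>2 \<tau> p u e y * vertex \<sigma>\<^sub>1 \<tau> e q x t)"
    using assms by (simp only: sum_vertex)
  moreover have "?R = (if p = 0 \<and> u = 0 then - \<sigma>\<^sub>1 else \<sigma>\<^sub>1) *
        (\<Sum>e\<in>K. vertex \<sigma>\<^sub>2 \<tau> p q x e * vertex \<sigma>\<^sub>3 \<tau> e u y t) +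
      \<tau> * (\<Sum>e\<in>K. vertex \<sigma>\<^sub>2 \<tau> u q x e * vertex \<sigma>\<^sub>3 \<tau> e p y t)"
    using assms by (simp only: sum_vertex)
  \<comment> \<open>Deciding which of the three incoming labels vanish settles all signs. The
    outgoing labels stay symbolic, and each case is a polynomial identity after substituting for
    \<open>\<sigma>\<^sub>2\<close>.\<close>
  ultimately show ?thesis
    using assms
    by (cases "p = 0"; cases "q = 0"; cases "u = 0")
      (simp_all add: sum_vertex_left sum_vertex_right, simp_all add: vertex_def algebra_simps)
qed

section \<open>Two stacked rows as one row of label pairs\<close>

lemma sum_pairs: "(\<Sum>d\<in>A \<times> B. F d) = (\<Sum>a\<in>A. \<Sum>b\<in>B. F (a, b))"
  by (simp add: sum.cartesian_product)

lemma sum_rotate3: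
  "(\<Sum>a\<in>A. \<Sum>b\<in>B. \<Sum>c\<in>C. F a b c) =
    (\<Sum>b\<in>B. \<Sum>c\<in>C. \<Sum>a\<in>A. (F a b c :: 'r::comm_monoid_add))"
  by (subst sum.swap) (simp add: sum.swap[of _ A C])

lemma sum_swap4:
  "(\<Sum>a\<in>A. \<Sum>b\<in>B. \<Sum>c\<in>C. \<Sum>d\<in>D. F a b c d) =
    (\<Sum>c\<in>C. \<Sum>d\<in>D. \<Sum>b\<in>B. \<Sum>a\<in>A. (F a b c d :: 'r::comm_monoid_add))"
proof -
  have "(\<Sum>a\<in>A. \<Sum>b\<in>B. \<Sum>c\<in>C. \<Sum>d\<in>D. F a b c d) =
      (\<Sum>b\<in>B. \<Sum>a\<in>A. \<Sum>c\<in>C. \<Sum>d\<in>D. F a b c d)"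
    by (rule sum.swap)
  also have "\<dots> = (\<Sum>(b, a)\<in>B \<times> A. \<Sum>(c, d)\<in>C \<times> D. F a b c d)"
    by (simp only: sum.cartesian_product[symmetric])
  also have "\<dots> = (\<Sum>(c, d)\<in>C \<times> D. \<Sum>(b, a)\<in>B \<times> A. F a b c d)"
    unfolding case_prod_unfold by (rule sum.swap)
  finally show ?thesis
    by (simp only: sum.cartesian_product[symmetric])
qed

text \<open>The label \<open>s j\<close> between the two rows enters only the factors of column
  \<open>j\<close>, so the sum over \<open>s\<close> splits into one sum per column. The result is a
  single product over columns, through which an \<open>R\<close>-vertex can be pushed.\<close>

lemma sum_mprod_pair:
  fixes f g :: "nat \<Rightarrow> 's \<Rightarrow> ('s, 'r::comm_ring_1) matrix"
  assumes "finite K" "a\<^sub>1 \<in> K" "a\<^sub>2 \<in> K" "c\<^sub>1 \<in> K" "c\<^sub>2 \<in> K"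
  shows "(\<Sum>s\<in>{1..n} \<rightarrow>\<^sub>E K. mprod K (map (\<lambda>j. f j (s j)) [1..<Suc n]) a\<^sub>1 c\<^sub>1 *
        mprod K (map (\<lambda>j. g j (s j)) [1..<Suc n]) a\<^sub>2 c\<^sub>2) =
    mprod (K \<times> K) (map (\<lambda>j (a\<^sub>1, a\<^sub>2) (c\<^sub>1, c\<^sub>2). \<Sum>k\<in>K. f j k a\<^sub>1 c\<^sub>1 * g j k a\<^sub>2 c\<^sub>2) [1..<Suc n])
      (a\<^sub>1, a\<^sub>2) (c\<^sub>1, c\<^sub>2)"
  using assms(4,5)
proof (induction n arbitrary: c\<^sub>1 c\<^sub>2)
  case 0
  then show ?case by simp
next
  case (Suc n)
  let ?F = "\<lambda>s. mprod K (map (\<lambda>j. f j (s j)) [1..<Suc n]) a\<^sub>1"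
  let ?G = "\<lambda>s. mprod K (map (\<lambda>j. g j (s j)) [1..<Suc n]) a\<^sub>2"
  let ?S = "{1..n} \<rightarrow>\<^sub>E K"
  let ?C = "\<lambda>j (a\<^sub>1, a\<^sub>2) (c\<^sub>1, c\<^sub>2). \<Sum>k\<in>K. f j k a\<^sub>1 c\<^sub>1 * g j k a\<^sub>2 c\<^sub>2"
  have insert: "{1..Suc n} = insert (Suc n) {1..n}"
    by auto
  have upt: "[1..<Suc (Suc n)] = [1..<Suc n] @ [Suc n]"
    by simp
  have map_upd: "map (\<lambda>j. h j (if j = Suc n then k else s j)) [Suc 0..<Suc n] =
      map (\<lambda>j. h j (s j)) [Suc 0..<Suc n]"
    for h :: "nat \<Rightarrow> 's \<Rightarrow> ('s, 'r) matrix" and s k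
    by simp
  have "(\<Sum>s\<in>{1..Suc n} \<rightarrow>\<^sub>E K. mprod K (map (\<lambda>j. f j (s j)) [1..<Suc (Suc n)]) a\<^sub>1 c\<^sub>1 *
        mprod K (map (\<lambda>j. g j (s j)) [1..<Suc (Suc n)]) a\<^sub>2 c\<^sub>2) =
      (\<Sum>k\<in>K. \<Sum>s\<in>?S. (\<Sum>d\<in>K. ?F s d * f (Suc n) k d c\<^sub>1) * (\<Sum>e\<in>K. ?G s e * g (Suc n) k e c\<^sub>2))"
    unfolding insert upt map_append
    by (subst sum_PiE_insert)
      (use assms Suc.prems in \<open>simp_all add: mprod_snoc map_upd del: upt_Suc\<close>)
  also have "\<dots> = (\<Sum>k\<in>K. \<Sum>s\<in>?S. \<Sum>d\<in>K. \<Sum>e\<in>K. ?F s d * ?G s e * (f (Suc n) k d c\<^sub>1 * g (Suc n) k e c\<^sub>2))"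
    by (simp only: sum_product mult_ac)
  also have "\<dots> = (\<Sum>d\<in>K. \<Sum>e\<in>K. (\<Sum>s\<in>?S. ?F s d * ?G s e) * (\<Sum>k\<in>K. f (Suc n) k d c\<^sub>1 * g (Suc n) k e c\<^sub>2))"
    by (subst sum_swap4) (simp only: sum_product)
  also have "\<dots> = (\<Sum>d\<in>K. \<Sum>e\<in>K. mprod (K \<times> K) (map ?C [1..<Suc n]) (a\<^sub>1, a\<^sub>2) (d, e) * ?C (Suc n) (d, e) (c\<^sub>1, c\<^sub>2))"
    using Suc.IH by (intro sum.cong) auto
  also have "\<dots> = mprod (K \<times> K) (map ?C [1..<Suc n] @ [?C (Suc n)]) (a\<^sub>1, a\<^sub>2) (c\<^sub>1, c\<^sub>2)"
    using assms(1-3) Suc.prems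
    by (subst mprod_snoc) (auto simp only: sum_pairs finite_cartesian_product)
  finally show ?case
    by simp
qed

section \<open>Row transfer matrices\<close>

fun straight_weight :: "row_type \<Rightarrow> nat \<Rightarrow> nat \<Rightarrow> int_mpoly" where
  "straight_weight Type_w k j = Var Ind_A + Var (Ind_x k) - Var (Ind_y j)"
| "straight_weight Type_e k j = Var Ind_B - Var (Ind_x k) + Var (Ind_y j)"

abbreviation elbow_weight :: int_mpoly where
  "elbow_weight \<equiv> Var Ind_A + Var Ind_B"

text \<open>The labels \<open>s\<close>, \<open>t\<close>, \<open>a\<close>, \<open>c\<close> sit on
  the South, North, West and East sides. All rows are multiplied from West to East, but in an e row
  the East label is the incoming one; hence the interchange of \<open>a\<close> and
  \<open>c\<close>.\<close>

fun cell_matrix :: "row_type \<Rightarrow> nat \<Rightarrow> nat \<Rightarrow> nat \<Rightarrow> nat \<Rightarrow> (nat, int_mpoly) matrix" where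
  "cell_matrix Type_w k j s t a c = vertex (straight_weight Type_w k j) elbow_weight a s c t"
| "cell_matrix Type_e k j s t a c = vertex (straight_weight Type_e k j) elbow_weight c s a t"

fun west_label :: "row_type \<Rightarrow> nat \<Rightarrow> nat" where
  "west_label Type_w k = k"
| "west_label Type_e k = 0"

fun east_label :: "row_type \<Rightarrow> nat \<Rightarrow> nat" where
  "east_label Type_w k = 0"
| "east_label Type_e k = k"

definition row_matrix ::
  "nat set \<Rightarrow> nat \<Rightarrow> row_type \<times> nat \<Rightarrow> (nat \<Rightarrow> nat, int_mpoly) matrix" where
  "row_matrix K n = (\<lambda>(b, k) t s.
    mprod K (map (\<lambda>j. cell_matrix b k j (s j) (t j)) [1..<Suc n]) (west_label b k) (east_label b k))"

text \<open>
  An \<open>R\<close>-vertex attached on the left of the two rows can be moved to their right. At either end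
  the boundary labels force the two lines to go straight through it.
\<close>

lemma row_matrix_swap:
  assumes "finite K" "0 \<in> K" "p \<in> K" "q \<in> K" "p \<noteq> 0" "q \<noteq> 0"
    and "t \<in> {1..n} \<rightarrow>\<^sub>E K" "u \<in> {1..n} \<rightarrow>\<^sub>E K"
  shows "(\<Sum>s\<in>{1..n} \<rightarrow>\<^sub>E K. row_matrix K n (Type_e, q) t s * row_matrix K n (Type_w, p) s u) =
    (\<Sum>s\<in>{1..n} \<rightarrow>\<^sub>E K. row_matrix K n (Type_w, p) t s * row_matrix K n (Type_e, q) s u)"
proof -
  define C where "C b\<^sub>1 k\<^sub>1 b\<^sub>2 k\<^sub>2 j = (\<lambda>(a\<^sub>1, a\<^sub>2) (c\<^sub>1, c\<^sub>2).
    \<Sum>k\<in>K. cell_matrix b\<^sub>1 k\<^sub>1 j k (t j) a\<^sub>1 c\<^sub>1 * cell_matrix b\<^sub>2 k\<^sub>2 j (u j) k a\<^sub>2 c\<^sub>2)" for b\<^sub>1 k\<^sub>1 b\<^sub>2 k\<^sub>2 j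
  define P where "P b\<^sub>1 k\<^sub>1 b\<^sub>2 k\<^sub>2 = mprod (K \<times> K) (map (C b\<^sub>1 k\<^sub>1 b\<^sub>2 k\<^sub>2) [1..<Suc n])" for b\<^sub>1 k\<^sub>1 b\<^sub>2 k\<^sub>2
  have two_rows: "(\<Sum>s\<in>{1..n} \<rightarrow>\<^sub>E K. row_matrix K n (b\<^sub>1, k\<^sub>1) t s * row_matrix K n (b\<^sub>2, k\<^sub>2) s u) =
      P b\<^sub>1 k\<^sub>1 b\<^sub>2 k\<^sub>2 (west_label b\<^sub>1 k\<^sub>1, west_label b\<^sub>2 k\<^sub>2) (east_label b\<^sub>1 k\<^sub>1, east_label b\<^sub>2 k\<^sub>2)"
    if "k\<^sub>1 \<in> K" "k\<^sub>2 \<in> K" for b\<^sub>1 k\<^sub>1 b\<^sub>2 k\<^sub>2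
    unfolding row_matrix_def prod.case P_def C_def
    by (rule sum_mprod_pair) (use assms that in \<open>cases b\<^sub>1; cases b\<^sub>2; simp\<close>)+
  \<comment> \<open>The sum of the straight weights of the two rows in any one column: the variable
    of the column cancels, so the same crossing serves for all columns.\<close>
  define \<sigma> where "\<sigma> = (Var Ind_A + Var (Ind_x p)) + (Var Ind_B - Var (Ind_x q))"
  \<comment> \<open>Pairs list the upper row first. The w line runs from lower left to upper right,
    the e line from lower right to upper left, so the e row is the upper one to the left of
    \<open>R\<close> and the lower one to its right.\<close>
  define R where "R = (\<lambda>(y, p) (x, q). vertex \<sigma> elbow_weight p q x y)"
  have local: "(\<Sum>d\<in>K \<times> K. R a d * C Type_w p Type_e q j d c) =
      (\<Sum>d\<in>K \<times> K. C Type_e q Type_w p j a d * R d c)"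
    if "a \<in> K \<times> K" "c \<in> K \<times> K" "j \<in> {1..n}" for a c j
  proof -
    obtain y p' x q' where ac: "a = (y, p')" "c = (x, q')" by (cases a; cases c)
    let ?w = "straight_weight Type_w p j" and ?e = "straight_weight Type_e q j"
    let ?V = "\<lambda>\<sigma>. vertex \<sigma> elbow_weight"
    have uj: "u j \<in> K" using assms that by auto
    have "(\<Sum>d\<in>K \<times> K. R a d * C Type_w p Type_e q j d c) =
        (\<Sum>e\<in>K. \<Sum>d\<in>K. \<Sum>k\<in>K. ?V ?e q' (u j) d k * (?V \<sigma> p' d e y * ?V ?w e k x (t j)))"
      by (simp add: ac R_def C_def sum_pairs sum_distrib_left mult_ac
          del: straight_weight.simps)
    also have "\<dots> = (\<Sum>d\<in>K. \<Sum>k\<in>K. ?V ?e q' (u j) d k * (\<Sum>e\<in>K. ?V \<sigma> p' d e y * ?V ?w e k x (t j)))"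
      by (subst sum_rotate3) (simp only: sum_distrib_left)
    also have "\<dots> = (\<Sum>d\<in>K. \<Sum>k\<in>K. ?V ?w p' (u j) d k * (\<Sum>e\<in>K. ?V \<sigma> d q' x e * ?V ?e e k y (t j)))"
      by (rule yang_baxter) (use assms that uj in \<open>auto simp: ac \<sigma>_def\<close>)
    also have "\<dots> = (\<Sum>e\<in>K. \<Sum>d\<in>K. \<Sum>k\<in>K. ?V ?w p' (u j) d k * (?V \<sigma> d q' x e * ?V ?e e k y (t j)))"
      by (subst sum_rotate3) (simp only: sum_distrib_left)
    also have "\<dots> = (\<Sum>d\<in>K \<times> K. C Type_e q Type_w p j a d * R d c)"
      by (simp add: ac R_def C_def sum_pairs sum_distrib_left sum_distrib_right
          mult_ac del: straight_weight.simps)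
    finally show ?thesis .
  qed
  have "\<sigma> * P Type_w p Type_e q (p, 0) (0, q) =
      (\<Sum>d\<in>K \<times> K. R (0, p) d * P Type_w p Type_e q d (0, q))"
  proof -
    have "R (0, p) d = of_bool (d = (p, 0)) * \<sigma>" for d
      using assms(5) by (cases d) (auto simp: R_def vertex_def)
    then show ?thesis
      using assms by (simp add: mult.assoc)
  qed
  also have "\<dots> = (\<Sum>d\<in>K \<times> K. P Type_e q Type_w p (0, p) d * R d (0, q))"
    unfolding P_def
    by (rule mprod_intertwine)
      (use assms local in \<open>auto simp: list.rel_map intro!: list.rel_refl_strong\<close>)
  also have "\<dots> = \<sigma> * P Type_e q Type_w p (0, p) (q, 0)"
  proof -
    have R: "R d (0, q) = of_bool (d = (q, 0)) * \<sigma>" for d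
      using assms(6) by (cases d) (auto simp: R_def vertex_def)
    show ?thesis
      using assms by (simp only: R mult.left_commute[of _ "of_bool _"]) (simp add: mult.commute)
  qed
  finally have "P Type_w p Type_e q (p, 0) (0, q) = P Type_e q Type_w p (0, p) (q, 0)"
    using crossing_weight_nonzero[of p q] by (simp add: \<sigma>_def)
  then show ?thesis
    using assms(3,4) by (simp only: two_rows west_label.simps east_label.simps)
qed

text \<open>With nothing coming from below, the pipe runs straight to one column and turns up there.
  West of that column the w row has horizontal tiles and the e row blanks, both of weight
  \<open>A + x - y\<close>; east of it the roles are exchanged, with weight
  \<open>B - x + y\<close>.\<close>

lemma row_matrix_bottom:
  assumes "finite K" "0 \<in> K" "q \<in> K" "q \<noteq> 0" and "\<And>j. j \<in> {1..n} \<Longrightarrow> z j = 0"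
  shows "row_matrix K n (Type_e, q) t z = row_matrix K n (Type_w, q) t z"
proof -
  let ?M = "\<lambda>b. map (\<lambda>j. cell_matrix b q j (z j) (t j)) [1..<Suc n]"
  \<comment> \<open>Exchanging \<open>0\<close> and \<open>q\<close> on the vertical edges exchanges
    blank and horizontal tiles and keeps the elbow, so it matches the two rows cell by cell.\<close>
  define \<theta> where "\<theta> a = (if a = 0 then q else 0)" for a :: nat
  have \<theta>: "bij_betw \<theta> {0, q} {0, q :: nat}"
    using assms(4) by (auto simp: bij_betw_def inj_on_def \<theta>_def)
  have "mprod K (?M Type_e) 0 q = mprod {0, q} (?M Type_e) 0 q"
    by (rule mprod_restrict_target) (use assms in \<open>auto simp: vertex_def\<close>)
  also have "\<dots> = mprod {0, q} (?M Type_w) (\<theta> 0) (\<theta> q)"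
    by (rule mprod_reindex[OF \<theta>])
      (use assms in \<open>auto simp: list.rel_map vertex_def \<theta>_def intro!: list.rel_refl_strong\<close>)
  also have "\<dots> = mprod K (?M Type_w) (\<theta> 0) (\<theta> q)"
    by (rule mprod_restrict_source[symmetric]) (use assms in \<open>auto simp: vertex_def \<theta>_def\<close>)
  finally show ?thesis
    using assms(4) by (simp add: row_matrix_def \<theta>_def del: upt_Suc)
qed

section \<open>Independence of the row types\<close>

text \<open>
  Removing the topmost row removes the first or the last pipe number, so the remaining numbers
  form an interval; \<open>a\<close> is the number before that interval.
\<close>

fun numbered_rows :: "nat \<Rightarrow> row_type list \<Rightarrow> (row_type \<times> nat) list" where
  "numbered_rows a [] = []"
| "numbered_rows a (Type_w # bs) = (Type_w, Suc a) # numbered_rows (Suc a) bs"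
| "numbered_rows a (Type_e # bs) = (Type_e, Suc (a + length bs)) # numbered_rows a bs"

lemma length_numbered_rows [simp]: "length (numbered_rows a bs) = length bs"
  by (induction a bs rule: numbered_rows.induct) auto

lemma set_numbered_rows: "snd ` set (numbered_rows a bs) = {Suc a..a + length bs}"
  by (induction a bs rule: numbered_rows.induct) auto

lemma numbered_rows_Type_w:
  "numbered_rows a (replicate l Type_w) = map (Pair Type_w) [Suc a..<Suc (a + l)]"
  by (induction l arbitrary: a) (auto simp: upt_conv_Cons simp del: upt_Suc)

lemma numbered_rows_nth:
  assumes "i < length bs"
  shows "numbered_rows a bs ! i =
    (bs ! i, case bs ! i of
       Type_w \<Rightarrow> a + length (filter (\<lambda>b. b = Type_w) (take (Suc i) bs))
     | Type_e \<Rightarrow> a + length (filter (\<lambda>b. b = Type_w) bs) + length (filter (\<lambda>b. b = Type_e) (drop i bs)))"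
  using assms
proof (induction a bs arbitrary: i rule: numbered_rows.induct)
  case (2 a bs)
  then show ?case
    by (cases i) (auto split: row_type.splits)
next
  case (3 a bs)
  \<comment> \<open>The recursion numbers a top e row by the total number of rows, the closed form
    by the counts of both types.\<close>
  have "length (filter (\<lambda>b. b = Type_w) bs) + length (filter (\<lambda>b. b = Type_e) bs) = length bs"
  proof (induction bs)
    case (Cons b bs)
    then show ?case by (cases b) auto
  qed simp
  with 3 show ?case
    by (cases i) (auto split: row_type.splits)
qed simp

lemma numbered_rows_eq_pipe_number:
  "numbered_rows 0 (map \<beta> [1..<Suc m]) = map (\<lambda>i. (\<beta> i, pipe_number m \<beta> i)) [1..<Suc m]"
proof (rule nth_equalityI)
  have card: "length (filter (\<lambda>b. b = c) (map \<beta> [k..<Suc l])) = card {r \<in> {k..l}. \<beta> r = c}" for c k l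
  proof -
    have "length (filter (\<lambda>b. b = c) (map \<beta> [k..<Suc l])) = length (filter (\<lambda>r. \<beta> r = c) [k..<Suc l])"
      by (simp add: filter_map o_def del: upt_Suc)
    also have "\<dots> = card (set (filter (\<lambda>r. \<beta> r = c) [k..<Suc l]))"
      by (rule distinct_card[symmetric]) simp
    also have "set (filter (\<lambda>r. \<beta> r = c) [k..<Suc l]) = {r \<in> {k..l}. \<beta> r = c}"
      by auto
    finally show ?thesis .
  qed
  fix i assume "i < length (numbered_rows 0 (map \<beta> [1..<Suc m]))"
  then have i: "i < m" by (simp del: upt_Suc)
  then have td: "take (Suc i) (map \<beta> [1..<Suc m]) = map \<beta> [1..<Suc (Suc i)]"
    "drop i (map \<beta> [1..<Suc m]) = map \<beta> [Suc i..<Suc m]"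
    by (simp_all add: take_map drop_map take_upt del: upt_Suc)
  show "numbered_rows 0 (map \<beta> [1..<Suc m]) ! i = map (\<lambda>i. (\<beta> i, pipe_number m \<beta> i)) [1..<Suc m] ! i"
    using i by (subst numbered_rows_nth) (simp_all only: td card,
      simp_all add: pipe_number_def del: upt_Suc split: row_type.splits)
qed simp

lemma bij_betw_pipe_number: "bij_betw (pipe_number m \<beta>) {1..m} {1..m}"
proof -
  have "pipe_number m \<beta> ` {1..m} = snd ` set (numbered_rows 0 (map \<beta> [1..<Suc m]))"
    unfolding numbered_rows_eq_pipe_number by (auto simp: image_image simp del: upt_Suc)
  also have "\<dots> = {1..m}"
    by (simp add: set_numbered_rows)
  finally show ?thesis
    by (simp add: bij_betw_def eq_card_imp_inj_on)
qed

text \<open>\<open>row_matrix_swap\<close> holds for all states above and below the two rows, so it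
  applies inside a longer product and the e row sinks past one w row at a time. At the bottom the
  zero state \<open>z\<close> permits \<open>row_matrix_bottom\<close>.\<close>

lemma mprod_row_to_bottom:
  assumes "finite K" "0 \<in> K" "q \<in> K" "q \<noteq> 0" and "\<And>k. k \<in> set ks \<Longrightarrow> k \<in> K \<and> k \<noteq> 0"
    and "z \<in> {1..n} \<rightarrow>\<^sub>E K" "\<And>j. j \<in> {1..n} \<Longrightarrow> z j = 0"
    and "t \<in> {1..n} \<rightarrow>\<^sub>E K"
  shows "mprod ({1..n} \<rightarrow>\<^sub>E K) (map (row_matrix K n) ((Type_e, q) # map (Pair Type_w) ks)) t z =
    mprod ({1..n} \<rightarrow>\<^sub>E K) (map (row_matrix K n) (map (Pair Type_w) (ks @ [q]))) t z"
  using assms(5,8)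
proof (induction ks arbitrary: t)
  case Nil
  have "finite ({1..n} \<rightarrow>\<^sub>E K)"
    using assms by (intro finite_PiE) auto
  with Nil assms show ?case
    using row_matrix_bottom[of K q n z t] by simp
next
  case (Cons k ks)
  let ?S = "{1..n} \<rightarrow>\<^sub>E K" and ?M = "row_matrix K n"
  let ?Z = "\<lambda>rs. mprod ?S (map ?M rs)"
  let ?ws = "map (Pair Type_w) ks"
  have "?Z ((Type_e, q) # map (Pair Type_w) (k # ks)) t z =
      (\<Sum>u\<in>?S. (\<Sum>s\<in>?S. ?M (Type_e, q) t s * ?M (Type_w, k) s u) * ?Z ?ws u z)"
    by (simp add: sum_distrib_left sum_distrib_right mult.assoc, rule sum.swap)
  also have "\<dots> = (\<Sum>u\<in>?S. (\<Sum>s\<in>?S. ?M (Type_w, k) t s * ?M (Type_e, q) s u) * ?Z ?ws u z)"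
    using assms(1-4) Cons.prems by (intro sum.cong arg_cong2[of _ _ _ _ "(*)"] row_matrix_swap) auto
  also have "\<dots> = (\<Sum>s\<in>?S. ?M (Type_w, k) t s * ?Z ((Type_e, q) # ?ws) s z)"
    by (simp add: sum_distrib_left sum_distrib_right mult.assoc, rule sum.swap)
  also have "\<dots> = (\<Sum>s\<in>?S. ?M (Type_w, k) t s * ?Z (map (Pair Type_w) (ks @ [q])) s z)"
    using Cons by (intro sum.cong) auto
  finally show ?case
    by simp
qed

text \<open>The rows below the top one are converted first, so a top e row has only w rows to pass.
  It carries the largest number of its interval, which is exactly the number of the bottom row when
  all types are w.\<close>

lemma mprod_numbered_rows:
  assumes "finite K" "0 \<in> K" "{1..a + length bs} \<subseteq> K"
    and "z \<in> {1..n} \<rightarrow>\<^sub>E K" "\<And>j. j \<in> {1..n} \<Longrightarrow> z j = 0"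
    and "t \<in> {1..n} \<rightarrow>\<^sub>E K"
  shows "mprod ({1..n} \<rightarrow>\<^sub>E K) (map (row_matrix K n) (numbered_rows a bs)) t z =
    mprod ({1..n} \<rightarrow>\<^sub>E K) (map (row_matrix K n) (numbered_rows a (replicate (length bs) Type_w))) t z"
  using assms(3,6)
proof (induction a bs arbitrary: t rule: numbered_rows.induct)
  case (2 a bs)
  then show ?case
    by (auto intro!: sum.cong)
next
  case (3 a bs)
  have sub: "{1..a + length bs} \<subseteq> K"
    using "3.prems" by auto
  have "mprod ({1..n} \<rightarrow>\<^sub>E K) (map (row_matrix K n) (numbered_rows a (Type_e # bs))) t z =
    mprod ({1..n} \<rightarrow>\<^sub>E K) (map (row_matrix K n) ((Type_e, Suc (a + length bs)) #
      numbered_rows a (replicate (length bs) Type_w))) t z"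
    using "3.IH"[OF sub] by (auto intro!: sum.cong)
  also have "\<dots> = mprod ({1..n} \<rightarrow>\<^sub>E K) (map (row_matrix K n)
      (map (Pair Type_w) ([Suc a..<Suc (a + length bs)] @ [Suc (a + length bs)]))) t z"
    unfolding numbered_rows_Type_w
    using 3 assms(1,2,4,5) by (intro mprod_row_to_bottom) auto
  also have "[Suc a..<Suc (a + length bs)] @ [Suc (a + length bs)] = [Suc a..<Suc (a + Suc (length bs))]"
    by simp
  finally show ?case
    unfolding numbered_rows_Type_w by (simp add: numbered_rows_Type_w del: upt_Suc replicate_Suc)
qed simp

section \<open>Labellings of the edges by pipe numbers\<close>

definition fits :: "tile \<Rightarrow> (side \<Rightarrow> nat) \<Rightarrow> bool" where
  "fits T f \<longleftrightarrow> (\<forall>s. meets T s \<longleftrightarrow> f s \<noteq> 0) \<and> (\<forall>s s'. {s, s'} \<in> segments T \<longrightarrow> f s = f s')"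

lemma all_side: "(\<forall>s. P s) \<longleftrightarrow> P North \<and> P South \<and> P East \<and> P West"
  by (metis side.exhaust)

lemma of_bool_mult_if:
  "of_bool P * of_bool Q * x = (if P \<and> Q then x else (0 :: 'r::comm_ring_1))"
  by simp

text \<open>One summand per tile. Four zero labels meet both conditions in \<open>vertex\<close> and
  give the single blank weight. If all labels are equal and nonzero, the cross and the double elbow
  both fit, in agreement with \<open>\<sigma> + \<tau>\<close>.\<close>

lemma vertex_eq_tiles:
  fixes \<sigma> \<tau> :: "'r::comm_ring_1"
  shows "vertex \<sigma> \<tau> w s e n =
    (if w = 0 \<and> s = 0 \<and> e = 0 \<and> n = 0 then \<tau> - \<sigma> else 0) +
    (if w \<noteq> 0 \<and> s = 0 \<and> e = w \<and> n = 0 then \<sigma> else 0) +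
    (if w = 0 \<and> s \<noteq> 0 \<and> e = 0 \<and> n = s then \<sigma> else 0) +
    (if w \<noteq> 0 \<and> s \<noteq> 0 \<and> e = w \<and> n = s then \<sigma> else 0) +
    (if w \<noteq> 0 \<and> s = 0 \<and> e = 0 \<and> n = w then \<tau> else 0) +
    (if w = 0 \<and> s \<noteq> 0 \<and> e = s \<and> n = 0 then \<tau> else 0) +
    (if w \<noteq> 0 \<and> s \<noteq> 0 \<and> e = s \<and> n = w then \<tau> else 0)"
proof (cases "w = 0")
  case True
  then show ?thesis
    by (cases "s = 0"; cases "e = 0"; cases "n = 0") (simp_all add: vertex_def)
next
  case w: False
  show ?thesis
  proof (cases "s = 0")
    case True
    with w show ?thesis
      by (cases "e = 0"; cases "n = 0") (simp_all add: vertex_def)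
  next
    case False
    with w show ?thesis
      by (simp add: vertex_def of_bool_mult_if conj_commute)
  qed
qed
lemma fits_Type_w:
  "fits Blank f \<longleftrightarrow> f West = 0 \<and> f South = 0 \<and> f East = 0 \<and> f North = 0"
  "fits Horizontal f \<longleftrightarrow> f West \<noteq> 0 \<and> f South = 0 \<and> f East = f West \<and> f North = 0"
  "fits Vertical f \<longleftrightarrow> f West = 0 \<and> f South \<noteq> 0 \<and> f East = 0 \<and> f North = f South"
  "fits Cross f \<longleftrightarrow> f West \<noteq> 0 \<and> f South \<noteq> 0 \<and> f East = f West \<and> f North = f South"
  "fits Elbow_WN f \<longleftrightarrow> f West \<noteq> 0 \<and> f South = 0 \<and> f East = 0 \<and> f North = f West"
  "fits Elbow_SE f \<longleftrightarrow> f West = 0 \<and> f South \<noteq> 0 \<and> f East = f South \<and> f North = 0"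
  "fits Elbow_WN_SE f \<longleftrightarrow> f West \<noteq> 0 \<and> f South \<noteq> 0 \<and> f East = f South \<and> f North = f West"
  by (auto simp: fits_def all_side meets_def doubleton_eq_iff)

text \<open>Reflection in a vertical line carries the e tiles to the w tiles. The conditions are
  arranged as in \<open>fits_Type_w\<close> with East and West interchanged, so that
  \<open>vertex_eq_tiles\<close> serves both types.\<close>

lemma fits_Type_e:
  "fits Blank f \<longleftrightarrow> f East = 0 \<and> f South = 0 \<and> f West = 0 \<and> f North = 0"
  "fits Horizontal f \<longleftrightarrow> f East \<noteq> 0 \<and> f South = 0 \<and> f West = f East \<and> f North = 0"
  "fits Vertical f \<longleftrightarrow> f East = 0 \<and> f South \<noteq> 0 \<and> f West = 0 \<and> f North = f South"
  "fits Cross f \<longleftrightarrow> f East \<noteq> 0 \<and> f South \<noteq> 0 \<and> f West = f East \<and> f North = f South"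
  "fits Elbow_EN f \<longleftrightarrow> f East \<noteq> 0 \<and> f South = 0 \<and> f West = 0 \<and> f North = f East"
  "fits Elbow_SW f \<longleftrightarrow> f East = 0 \<and> f South \<noteq> 0 \<and> f West = f South \<and> f North = 0"
  "fits Elbow_EN_SW f \<longleftrightarrow> f East \<noteq> 0 \<and> f South \<noteq> 0 \<and> f West = f South \<and> f North = f East"
  by (auto simp: fits_def all_side meets_def doubleton_eq_iff)

lemma sum_fitting_tile_weights:
  fixes \<sigma> \<tau> :: "'r::comm_ring_1"
  shows "(\<Sum>T\<in>allowed_tiles b. if fits T f then
        (if T = Blank then \<tau> - \<sigma> else if T \<in> straight_tiles then \<sigma> else \<tau>) else 0) =
    (case b of Type_w \<Rightarrow> vertex \<sigma> \<tau> (f West) (f South) (f East) (f North)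
      | Type_e \<Rightarrow> vertex \<sigma> \<tau> (f East) (f South) (f West) (f North))"
proof -
  have 1: "(\<Sum>T\<in>allowed_tiles Type_w. g T) = g Blank + g Horizontal + g Vertical + g Cross +
      g Elbow_WN + g Elbow_SE + g Elbow_WN_SE" for g :: "tile \<Rightarrow> 'r"
    by (simp add: allowed_tiles_def straight_tiles_def)
  have 2: "(\<Sum>T\<in>allowed_tiles Type_e. g T) = g Blank + g Horizontal + g Vertical + g Cross +
      g Elbow_EN + g Elbow_SW + g Elbow_EN_SW" for g :: "tile \<Rightarrow> 'r"
    by (simp add: allowed_tiles_def straight_tiles_def)
  have 3: "T \<in> straight_tiles \<longleftrightarrow> T = Horizontal \<or> T = Vertical \<or> T = Cross" for T
    by (auto simp: straight_tiles_def)
  show ?thesis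
  proof (cases b)
    case Type_w
    show ?thesis
      by (simp only: Type_w 1 3 row_type.case fits_Type_w vertex_eq_tiles tile.distinct simp_thms if_True if_False)
  next
    case Type_e
    show ?thesis
      by (simp only: Type_e 2 3 row_type.case fits_Type_e vertex_eq_tiles tile.distinct simp_thms if_True if_False)
  qed
qed

lemma tile_weight_eq:
  assumes "T \<in> allowed_tiles (\<beta> i)"
  shows "tile_weight m \<beta> i j T =
    (if T = Blank then elbow_weight - straight_weight (\<beta> i) (pipe_number m \<beta> i) j
     else if T \<in> straight_tiles then straight_weight (\<beta> i) (pipe_number m \<beta> i) j
     else elbow_weight)"
  by (cases "\<beta> i") (simp_all add: tile_weight_def)

lemma sum_fitting_tiles:
  "(\<Sum>T | T \<in> allowed_tiles (\<beta> i) \<and> fits T f. tile_weight m \<beta> i j T) =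
    cell_matrix (\<beta> i) (pipe_number m \<beta> i) j (f South) (f North) (f West) (f East)"
proof -
  define \<sigma> \<tau> where "\<sigma> = straight_weight (\<beta> i) (pipe_number m \<beta> i) j" and "\<tau> = elbow_weight"
  have fin: "finite (allowed_tiles (\<beta> i))"
    by (cases "\<beta> i") (auto simp: allowed_tiles_def straight_tiles_def)
  have "(\<Sum>T | T \<in> allowed_tiles (\<beta> i) \<and> fits T f. tile_weight m \<beta> i j T) =
      (\<Sum>T\<in>allowed_tiles (\<beta> i). if fits T f then
        (if T = Blank then \<tau> - \<sigma> else if T \<in> straight_tiles then \<sigma> else \<tau>) else 0)"
    unfolding \<sigma>_def \<tau>_def
    by (subst sum.inter_filter[OF fin]) (rule sum.cong[OF refl], simp only: tile_weight_eq)
  also have "\<dots> = (case \<beta> i of Type_w \<Rightarrow> vertex \<sigma> \<tau> (f West) (f South) (f East) (f North)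
      | Type_e \<Rightarrow> vertex \<sigma> \<tau> (f East) (f South) (f West) (f North))"
    by (rule sum_fitting_tile_weights)
  also have "\<dots> = cell_matrix (\<beta> i) (pipe_number m \<beta> i) j (f South) (f North) (f West) (f East)"
    by (cases "\<beta> i") (simp_all add: \<sigma>_def \<tau>_def)
  finally show ?thesis .
qed

section \<open>Pipes as paths from the entry edges\<close>

text \<open>The direction of travel from the entry edge: in either row type a pipe enters a tile
  through two of the sides and leaves through the other two.\<close>

fun incoming :: "row_type \<Rightarrow> side \<Rightarrow> bool" where
  "incoming Type_w s \<longleftrightarrow> s = West \<or> s = South"
| "incoming Type_e s \<longleftrightarrow> s = East \<or> s = South"

lemma segments_cases:
  assumes "T \<in> allowed_tiles b"
  obtains "segments T = {}" | "segments T = {{West, East}}" | "segments T = {{South, North}}"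
  | "segments T = {{West, East}, {South, North}}"
  | "b = Type_w" "segments T = {{West, North}}" | "b = Type_w" "segments T = {{South, East}}"
  | "b = Type_w" "segments T = {{West, North}, {South, East}}"
  | "b = Type_e" "segments T = {{East, North}}" | "b = Type_e" "segments T = {{South, West}}"
  | "b = Type_e" "segments T = {{East, North}, {South, West}}"
  using assms by (cases T; cases b) (auto simp: allowed_tiles_def straight_tiles_def)

lemma segment_outgoing:
  assumes "T \<in> allowed_tiles b" "{s, s'} \<in> segments T" "incoming b s"
  shows "\<not> incoming b s'"
  using assms by (elim segments_cases; cases b) (auto simp: doubleton_eq_iff)

lemma segment_incoming:
  assumes "T \<in> allowed_tiles b" "{s, s'} \<in> segments T"
  shows "incoming b s \<or> incoming b s'"
  using assms by (elim segments_cases; cases b) (auto simp: doubleton_eq_iff)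

lemma segment_unique:
  assumes "T \<in> allowed_tiles b" "{s\<^sub>1, s} \<in> segments T" "{s\<^sub>2, s} \<in> segments T"
  shows "s\<^sub>1 = s\<^sub>2"
  using assms by (elim segments_cases; cases b) (auto simp: doubleton_eq_iff)

lemma segment_exists:
  assumes "T \<in> allowed_tiles b" "meets T s" "\<not> incoming b s"
  obtains s\<^sub>0 where "incoming b s\<^sub>0" "{s\<^sub>0, s} \<in> segments T"
proof -
  from assms(2) obtain s\<^sub>0 where s\<^sub>0: "{s\<^sub>0, s} \<in> segments T"
    using assms(1) unfolding meets_def
    by (elim segments_cases) (auto simp: doubleton_eq_iff insert_commute)
  then show ?thesis
    using that segment_incoming[OF assms(1) s\<^sub>0] assms(3) by blast
qed

text \<open>\<open>joined\<close> relates the ends of a segment both ways. Keeping only the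
  direction of travel makes predecessors unique.\<close>

definition flow ::
  "nat \<Rightarrow> nat \<Rightarrow> (nat \<Rightarrow> row_type) \<Rightarrow> (nat \<times> nat \<Rightarrow> tile) \<Rightarrow> (grid_edge \<times> grid_edge) set" where
  "flow m n \<beta> D =
    {(cell_edge i j s, cell_edge i j s') | i j s s'.
      i \<in> {1..m} \<and> j \<in> {1..n} \<and> {s, s'} \<in> segments (D (i, j)) \<and> incoming (\<beta> i) s}"

lemma flow_subset_joined: "flow m n \<beta> D \<subseteq> joined m n D"
  unfolding flow_def joined_def by blast

locale tiling =
  fixes m n :: nat and \<beta> :: "nat \<Rightarrow> row_type" and D :: "nat \<times> nat \<Rightarrow> tile"
  assumes allowed: "\<And>i j. i \<in> {1..m} \<Longrightarrow> j \<in> {1..n} \<Longrightarrow> D (i, j) \<in> allowed_tiles (\<beta> i)"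
begin

abbreviation entry :: "nat \<Rightarrow> grid_edge" where
  "entry i \<equiv> entry_edge n (\<beta> i) i"

lemma outgoing_side_unique:
  assumes "cell_edge i j s = cell_edge i' j' s'" "\<not> incoming (\<beta> i) s" "\<not> incoming (\<beta> i') s'"
    and "i \<in> {1..m}" "j \<in> {1..n}" "i' \<in> {1..m}" "j' \<in> {1..n}"
  shows "i = i' \<and> j = j' \<and> s = s'"
  using assms by (cases s; cases s'; cases "\<beta> i"; cases "\<beta> i'") auto

lemma flow_source_unique:
  assumes "(e\<^sub>1, e) \<in> flow m n \<beta> D" "(e\<^sub>2, e) \<in> flow m n \<beta> D"
  shows "e\<^sub>1 = e\<^sub>2"
proof -
  obtain i j s s' where 1: "e\<^sub>1 = cell_edge i j s" "e = cell_edge i j s'" "i \<in> {1..m}" "j \<in> {1..n}"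
    "{s, s'} \<in> segments (D (i, j))" "incoming (\<beta> i) s"
    using assms(1) unfolding flow_def by blast
  obtain i' j' t t' where 2: "e\<^sub>2 = cell_edge i' j' t" "e = cell_edge i' j' t'" "i' \<in> {1..m}" "j' \<in> {1..n}"
    "{t, t'} \<in> segments (D (i', j'))" "incoming (\<beta> i') t"
    using assms(2) unfolding flow_def by blast
  have "i = i' \<and> j = j' \<and> s' = t'"
    using 1 2 segment_outgoing allowed by (intro outgoing_side_unique) metis+
  then show ?thesis
    using 1 2 segment_unique allowed by metis
qed

lemma entry_not_flow_target:
  assumes "i \<in> {1..m}"
  shows "(e, entry i) \<notin> flow m n \<beta> D"
proof
  assume "(e, entry i) \<in> flow m n \<beta> D"
  then obtain i' j s s' where *: "entry i = cell_edge i' j s'" "i' \<in> {1..m}" "j \<in> {1..n}"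
    "{s, s'} \<in> segments (D (i', j))" "incoming (\<beta> i') s"
    unfolding flow_def by blast
  then have "\<not> incoming (\<beta> i') s'"
    using segment_outgoing allowed by metis
  with * show False
    by (cases s'; cases "\<beta> i"; cases "\<beta> i'") auto
qed

lemma entry_inj: "entry i = entry i' \<Longrightarrow> i = i'"
  by (cases "\<beta> i"; cases "\<beta> i'") auto

text \<open>Going backwards is deterministic and must stop at an entry edge, which has no
  predecessor.\<close>

lemma flow_entry_unique:
  assumes "(entry i, e) \<in> (flow m n \<beta> D)\<^sup>*" "(entry i', e) \<in> (flow m n \<beta> D)\<^sup>*"
    and "i \<in> {1..m}" "i' \<in> {1..m}"
  shows "i = i'"
  using assms(1,2)
proof (induction rule: rtrancl_induct)
  case base
  then show ?case
    using entry_not_flow_target[OF assms(3)] entry_inj by (metis rtranclE)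
next
  case (step y z)
  from step.prems show ?case
  proof (cases rule: rtranclE)
    case base
    then show ?thesis
      using entry_not_flow_target[OF assms(4)] step by metis
  next
    case (step y')
    then show ?thesis
      using flow_source_unique \<open>(y, z) \<in> flow m n \<beta> D\<close> \<open>(entry i', y) \<in> (flow m n \<beta> D)\<^sup>* \<Longrightarrow> i = i'\<close>
      by metis
  qed
qed

text \<open>The rank increases along the flow, so that no pipe closes up to a loop.\<close>

definition row_offset :: "nat \<Rightarrow> nat" where
  "row_offset i = (m - i) * (n + 2)"

text \<open>Row \<open>i\<close> uses one value for its South edges and \<open>n + 1\<close> values
  for its vertical edges, ordered by direction of travel; hence the spacing \<open>n + 2\<close>
  between rows.\<close>

definition rank :: "grid_edge \<Rightarrow> nat" where
  "rank e = (case e of HEdge i j \<Rightarrow> row_offset i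
    | VEdge i j \<Rightarrow> row_offset i + 1 + (case \<beta> i of Type_w \<Rightarrow> j | Type_e \<Rightarrow> n - j))"

lemma rank_less:
  assumes "i \<in> {1..m}" "j \<in> {1..n}" "incoming (\<beta> i) s" "\<not> incoming (\<beta> i) s'"
  shows "rank (cell_edge i j s) < rank (cell_edge i j s')"
proof -
  have "m - (i - 1) = Suc (m - i)"
    using assms(1) by auto
  then have "row_offset (i - 1) = row_offset i + (n + 2)"
    by (simp add: row_offset_def)
  then show ?thesis
    using assms by (cases s; cases s'; cases "\<beta> i") (auto simp: rank_def)
qed

end

locale pipe_dream =
  fixes m n :: nat and \<beta> :: "nat \<Rightarrow> row_type" and D :: "nat \<times> nat \<Rightarrow> tile"
  assumes n_pos: "1 \<le> n" and pipe_dream: "D \<in> pipe_dreams m n \<beta>"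

sublocale pipe_dream \<subseteq> tiling
  using pipe_dream by unfold_locales (auto simp: pipe_dreams_def PiE_iff)

context pipe_dream
begin

lemma meets_adjacent:
  assumes "cell_edge i j s = cell_edge i' j' s'"
    and "i \<in> {1..m}" "j \<in> {1..n}" "i' \<in> {1..m}" "j' \<in> {1..n}"
  shows "meets (D (i, j)) s \<longleftrightarrow> meets (D (i', j')) s'"
proof -
  have EW: "meets (D (i, j)) East \<longleftrightarrow> meets (D (i, Suc j)) West" if "i \<in> {1..m}" "1 \<le> j" "j < n" for i j
    using pipe_dream that by (auto simp: pipe_dreams_def)
  have SN: "meets (D (i, j)) South \<longleftrightarrow> meets (D (Suc i, j)) North" if "1 \<le> i" "i < m" "j \<in> {1..n}" for i j
    using pipe_dream that by (auto simp: pipe_dreams_def)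
  have cells: "1 \<le> i" "i \<le> m" "1 \<le> j" "j \<le> n" "1 \<le> i'" "i' \<le> m" "1 \<le> j'" "j' \<le> n"
    using assms by auto
  have "s' = s \<and> i' = i \<and> j' = j \<or>
      s = East \<and> s' = West \<and> i' = i \<and> j' = Suc j \<or> s = West \<and> s' = East \<and> i' = i \<and> j = Suc j' \<or>
      s = South \<and> s' = North \<and> i' = Suc i \<and> j' = j \<or> s = North \<and> s' = South \<and> i = Suc i' \<and> j' = j"
    using assms(1) cells by (cases s; cases s') auto
  then show ?thesis
    using EW[of i j] EW[of i' j'] SN[of i j] SN[of i' j'] assms(2-5) cells by (elim disjE conjE) auto
qed

text \<open>Tracing a pipe backwards lowers the rank, so it ends, and the boundary conditions let it
  end only at an entry edge.\<close>

lemma reachable: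
  assumes "i \<in> {1..m}" "j \<in> {1..n}" "meets (D (i, j)) s"
  shows "\<exists>r\<in>{1..m}. (entry r, cell_edge i j s) \<in> (flow m n \<beta> D)\<^sup>*"
  using assms
proof (induction "rank (cell_edge i j s)" arbitrary: i j s rule: less_induct)
  case less
  \<comment> \<open>An outgoing side is traced back through its own cell. An incoming side off the
    boundary is an outgoing side of the neighbouring cell, so this covers it too.\<close>
  have out: "\<exists>r\<in>{1..m}. (entry r, cell_edge i j s) \<in> (flow m n \<beta> D)\<^sup>*"
    if eq: "cell_edge i j s = cell_edge i' j' s'" and cell: "i' \<in> {1..m}" "j' \<in> {1..n}"
      and o: "\<not> incoming (\<beta> i') s'" for i' j' s'
  proof -
    have "meets (D (i', j')) s'"
      using meets_adjacent[OF eq] less.prems cell by simp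
    then obtain s\<^sub>0 where s\<^sub>0: "incoming (\<beta> i') s\<^sub>0" "{s\<^sub>0, s'} \<in> segments (D (i', j'))"
      using segment_exists allowed cell o by metis
    have "rank (cell_edge i' j' s\<^sub>0) < rank (cell_edge i j s)"
      unfolding eq using rank_less cell s\<^sub>0 o by simp
    moreover have "meets (D (i', j')) s\<^sub>0"
      using s\<^sub>0 by (auto simp: meets_def)
    ultimately obtain r where "r \<in> {1..m}" "(entry r, cell_edge i' j' s\<^sub>0) \<in> (flow m n \<beta> D)\<^sup>*"
      using less.hyps cell by blast
    moreover have "(cell_edge i' j' s\<^sub>0, cell_edge i j s) \<in> flow m n \<beta> D"
      unfolding eq flow_def using cell s\<^sub>0 by blast
    ultimately show ?thesis
      by (meson rtrancl.rtrancl_into_rtrancl)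
  qed
  show ?case
  proof (cases "incoming (\<beta> i) s")
    case False
    then show ?thesis using out less.prems by blast
  next
    case True
    then consider "s = South" | "\<beta> i = Type_w" "s = West" | "\<beta> i = Type_e" "s = East"
      by (cases "\<beta> i") auto
    then show ?thesis
    proof cases
      case 1
      have "i \<noteq> m"
        using less.prems 1 pipe_dream by (auto simp: pipe_dreams_def)
      then show ?thesis
        using less.prems 1 by (intro out[of "Suc i" j North]) (cases "\<beta> (Suc i)"; auto)+
    next
      case 2
      show ?thesis
      proof (cases "j = 1")
        case True
        then have "cell_edge i j s = entry i"
          using 2 by simp
        then show ?thesis
          using less.prems by auto
      next
        case False
        then show ?thesis
          using less.prems 2 by (intro out[of i "j - 1" East]) auto
      qed
    next
      case 3
      show ?thesis
      proof (cases "j = n")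
        case True
        then have "cell_edge i j s = entry i"
          using 3 by simp
        then show ?thesis
          using less.prems by auto
      next
        case False
        then show ?thesis
          using less.prems 3 by (intro out[of i "Suc j" West]) auto
      qed
    qed
  qed
qed

end

section \<open>Existence and uniqueness of labellings, and connectivity\<close>

definition labelling ::
  "nat \<Rightarrow> nat \<Rightarrow> (nat \<Rightarrow> row_type) \<Rightarrow> (nat \<times> nat \<Rightarrow> tile) \<Rightarrow> (grid_edge \<Rightarrow> nat) \<Rightarrow> bool" where
  "labelling m n \<beta> D L \<longleftrightarrow>
    (\<forall>i\<in>{1..m}. \<forall>j\<in>{1..n}. fits (D (i, j)) (\<lambda>s. L (cell_edge i j s))) \<and>
    (\<forall>i\<in>{1..m}. L (VEdge i 0) = west_label (\<beta> i) (pipe_number m \<beta> i) \<and>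
      L (VEdge i n) = east_label (\<beta> i) (pipe_number m \<beta> i)) \<and>
    (\<forall>j\<in>{1..n}. L (HEdge m j) = 0)"

lemma labelling_joined:
  assumes "labelling m n \<beta> D L" "(e, e') \<in> (joined m n D)\<^sup>*"
  shows "L e = L e'"
  using assms(2)
proof (induction rule: rtrancl_induct)
  case (step y z)
  then show ?case
    using assms(1) unfolding labelling_def joined_def fits_def by fastforce
qed simp

lemma labelling_entry:
  assumes "labelling m n \<beta> D L" "i \<in> {1..m}"
  shows "L (entry_edge n (\<beta> i) i) = pipe_number m \<beta> i"
  using assms unfolding labelling_def by (cases "\<beta> i") auto

text \<open>Pipe numbers are nonzero, so the prescribed boundary labels decide which boundary edges
  carry a pipe; inside, adjacent cells read the same label.\<close>

lemma labelling_imp_pipe_dream: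
  assumes "labelling m n \<beta> D L"
    and "D \<in> (\<Pi>\<^sub>E (i, j) \<in> {1..m} \<times> {1..n}. allowed_tiles (\<beta> i))" and "1 \<le> m" "1 \<le> n"
  shows "D \<in> pipe_dreams m n \<beta>"
proof -
  have meets: "meets (D (i, j)) s \<longleftrightarrow> L (cell_edge i j s) \<noteq> 0" if "i \<in> {1..m}" "j \<in> {1..n}" for i j s
    using assms(1) that unfolding labelling_def fits_def by blast
  have pos: "pipe_number m \<beta> i \<noteq> 0" if "i \<in> {1..m}" for i
    using bij_betw_pipe_number[of m \<beta>] that by (force simp: bij_betw_def)
  have west: "L (VEdge i 0) = west_label (\<beta> i) (pipe_number m \<beta> i)"
    and east: "L (VEdge i n) = east_label (\<beta> i) (pipe_number m \<beta> i)" if "i \<in> {1..m}" for i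
    using assms(1) that by (auto simp: labelling_def)
  have south: "L (HEdge m j) = 0" if "j \<in> {1..n}" for j
    using assms(1) that by (auto simp: labelling_def)
  show ?thesis
    unfolding pipe_dreams_def
    using assms(2-4) pos by (auto simp: meets west east south)
qed

text \<open>Every occupied edge is joined to an entry edge, where the label is prescribed. Thus each
  pipe dream is counted only once in the sum over labels.\<close>

lemma labelling_unique:
  assumes "D \<in> pipe_dreams m n \<beta>" "1 \<le> n" "labelling m n \<beta> D L" "labelling m n \<beta> D L'"
    and "i \<in> {1..m}" "j \<in> {1..n}"
  shows "L (cell_edge i j s) = L' (cell_edge i j s)"
proof -
  interpret pipe_dream m n \<beta> D
    using assms by unfold_locales
  show ?thesis
  proof (cases "meets (D (i, j)) s")
    case True
    then obtain r where "r \<in> {1..m}" "(entry r, cell_edge i j s) \<in> (joined m n D)\<^sup>*"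
      using reachable assms rtrancl_mono[OF flow_subset_joined] by blast
    then show ?thesis
      using assms labelling_joined labelling_entry by metis
  next
    case False
    then show ?thesis
      using assms unfolding labelling_def fits_def by metis
  qed
qed

text \<open>Labels are constant along pipes. Conversely, a nonzero label at the top marks a pipe
  that can be traced back to an entry, and the label identifies its row because pipe numbers are
  distinct.\<close>

lemma labelling_connectivity:
  assumes "labelling m n \<beta> D L" "D \<in> pipe_dreams m n \<beta>" "1 \<le> n"
    and "\<And>k. k \<in> {1..m} \<Longrightarrow> \<pi> k \<in> {1..n}"
  shows "has_connectivity m n \<beta> D \<pi> \<longleftrightarrow> (\<forall>k\<in>{1..m}. L (HEdge 0 (\<pi> k)) = k)"
proof
  assume con: "has_connectivity m n \<beta> D \<pi>"
  show "\<forall>k\<in>{1..m}. L (HEdge 0 (\<pi> k)) = k"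
  proof
    fix k assume "k \<in> {1..m}"
    then have "k \<in> pipe_number m \<beta> ` {1..m}"
      by (simp only: bij_betw_imp_surj_on[OF bij_betw_pipe_number])
    then obtain i where i: "i \<in> {1..m}" "k = pipe_number m \<beta> i"
      by blast
    then have "(entry_edge n (\<beta> i) i, HEdge 0 (\<pi> k)) \<in> (joined m n D)\<^sup>*"
      using con by (simp add: has_connectivity_def)
    then show "L (HEdge 0 (\<pi> k)) = k"
      using labelling_joined[OF assms(1)] labelling_entry[OF assms(1)] i by metis
  qed
next
  interpret pipe_dream m n \<beta> D
    using assms by unfold_locales
  assume lab: "\<forall>k\<in>{1..m}. L (HEdge 0 (\<pi> k)) = k"
  show "has_connectivity m n \<beta> D \<pi>"
    unfolding has_connectivity_def
  proof
    fix i assume i: "i \<in> {1..m}"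
    let ?k = "pipe_number m \<beta> i"
    have k: "?k \<in> {1..m}"
      using bij_betw_pipe_number i by (blast dest: bij_betwE)
    have edge: "HEdge 0 (\<pi> ?k) = cell_edge 1 (\<pi> ?k) North"
      by simp
    have one: "1 \<in> {1..m}"
      using i by auto
    have "L (cell_edge 1 (\<pi> ?k) North) \<noteq> 0"
      using lab k edge by auto
    then have "meets (D (1, \<pi> ?k)) North"
      using assms(1,4) k one unfolding labelling_def fits_def by blast
    then obtain r where r: "r \<in> {1..m}" "(entry r, HEdge 0 (\<pi> ?k)) \<in> (joined m n D)\<^sup>*"
      unfolding edge
      using reachable[OF one assms(4)[OF k]] rtrancl_mono[OF flow_subset_joined] by blast
    then have "pipe_number m \<beta> r = ?k"
      using labelling_joined[OF assms(1)] labelling_entry[OF assms(1)] lab k by metis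
    then have "r = i"
      using bij_betw_pipe_number r(1) i by (metis bij_betw_def inj_onD)
    then show "(entry i, HEdge 0 (\<pi> ?k)) \<in> (joined m n D)\<^sup>*"
      using r by simp
  qed
qed

lemma labelling_exists:
  assumes "D \<in> pipe_dreams m n \<beta>" "1 \<le> n"
  obtains L where "labelling m n \<beta> D L" "\<And>e. L e \<in> {0..m}"
proof -
  interpret pipe_dream m n \<beta> D
    using assms by unfold_locales
  let ?F = "(flow m n \<beta> D)\<^sup>*"
  \<comment> \<open>The entry from which the flow reaches \<open>e\<close> is unique by
    \<open>flow_entry_unique\<close>; the default \<open>0\<close> marks the edges without
    pipe.\<close>
  define L where "L e = (if \<exists>r\<in>{1..m}. (entry r, e) \<in> ?F
    then pipe_number m \<beta> (THE r. r \<in> {1..m} \<and> (entry r, e) \<in> ?F) else 0)" for e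
  have L: "L e = pipe_number m \<beta> r" if "r \<in> {1..m}" "(entry r, e) \<in> ?F" for r e
  proof -
    have "(THE r. r \<in> {1..m} \<and> (entry r, e) \<in> ?F) = r"
      using that flow_entry_unique by blast
    then show ?thesis
      using that by (auto simp: L_def)
  qed
  have range: "pipe_number m \<beta> r \<in> {1..m}" if "r \<in> {1..m}" for r
    using bij_betw_pipe_number that by (blast dest: bij_betwE)
  have meets: "meets (D (i, j)) s \<longleftrightarrow> L (cell_edge i j s) \<noteq> 0" if cell: "i \<in> {1..m}" "j \<in> {1..n}" for i j s
  proof
    assume "meets (D (i, j)) s"
    then obtain r where "r \<in> {1..m}" "(entry r, cell_edge i j s) \<in> ?F"
      using reachable cell by blast
    then show "L (cell_edge i j s) \<noteq> 0"
      using L range by force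
  next
    assume "L (cell_edge i j s) \<noteq> 0"
    then obtain r where r: "r \<in> {1..m}" "(entry r, cell_edge i j s) \<in> ?F"
      by (auto simp: L_def split: if_splits)
    from r(2) show "meets (D (i, j)) s"
    proof (cases rule: rtranclE)
      case base
      then show ?thesis
        using r(1) cell assms by (cases s; cases "\<beta> r") (auto simp: pipe_dreams_def)
    next
      case (step e)
      then obtain i' j' t t' where *: "cell_edge i j s = cell_edge i' j' t'" "i' \<in> {1..m}" "j' \<in> {1..n}"
        "{t, t'} \<in> segments (D (i', j'))"
        unfolding flow_def by blast
      then have "meets (D (i', j')) t'"
        by (auto simp: meets_def)
      then show ?thesis
        using meets_adjacent * cell by metis
    qed
  qed
  have flow: "L e = L e'" if step: "(e, e') \<in> flow m n \<beta> D" for e e'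
  proof -
    obtain i j s s' where *: "e = cell_edge i j s" "i \<in> {1..m}" "j \<in> {1..n}" "{s, s'} \<in> segments (D (i, j))"
      using step unfolding flow_def by blast
    then have "meets (D (i, j)) s"
      by (auto simp: meets_def)
    then obtain r where "r \<in> {1..m}" "(entry r, e) \<in> ?F"
      using reachable * by blast
    then show ?thesis
      using L step by (metis rtrancl.rtrancl_into_rtrancl)
  qed
  have "L (cell_edge i j s) = L (cell_edge i j s')"
    if cell: "i \<in> {1..m}" "j \<in> {1..n}" and seg: "{s, s'} \<in> segments (D (i, j))" for i j s s'
  proof (cases "incoming (\<beta> i) s")
    case True
    then show ?thesis
      using that by (intro flow) (auto simp: flow_def)
  next
    case False
    then have "incoming (\<beta> i) s'"
      using segment_incoming[OF allowed[OF cell] seg] by simp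
    then have "L (cell_edge i j s') = L (cell_edge i j s)"
      using that by (intro flow) (auto simp: flow_def insert_commute)
    then show ?thesis by simp
  qed
  moreover have "L (VEdge i 0) = west_label (\<beta> i) (pipe_number m \<beta> i) \<and>
      L (VEdge i n) = east_label (\<beta> i) (pipe_number m \<beta> i)" if i: "i \<in> {1..m}" for i
  proof -
    have "L (entry i) = pipe_number m \<beta> i"
      using L i by blast
    moreover have "\<beta> i = Type_w \<Longrightarrow> \<not> meets (D (i, n)) East" "\<beta> i = Type_e \<Longrightarrow> \<not> meets (D (i, 1)) West"
      using assms(1) i by (auto simp: pipe_dreams_def)
    ultimately show ?thesis
      using meets[OF i, of n East] meets[OF i, of 1 West] assms(2) by (cases "\<beta> i") auto
  qed
  moreover have "L (HEdge m j) = 0" if j: "j \<in> {1..n}" for j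
  proof (cases "m = 0")
    case True
    then show ?thesis by (simp add: L_def)
  next
    case False
    then have "\<not> meets (D (m, j)) South"
      using assms(1) j by (auto simp: pipe_dreams_def)
    then show ?thesis
      using meets[of m j South] False j by simp
  qed
  ultimately have "labelling m n \<beta> D L"
    by (simp add: labelling_def fits_def meets)
  moreover have "L e \<in> {0..m}" for e
    using L range by (cases "\<exists>r\<in>{1..m}. (entry r, e) \<in> ?F") (force simp: L_def)+
  ultimately show ?thesis
    using that by blast
qed

section \<open>Generic pipe dream polynomials as transfer matrix products\<close>

fun edge_label :: "(nat \<Rightarrow> nat \<Rightarrow> nat) \<Rightarrow> (nat \<Rightarrow> nat \<Rightarrow> nat) \<Rightarrow> grid_edge \<Rightarrow> nat" where
  "edge_label h v (HEdge i j) = h i j"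
| "edge_label h v (VEdge i j) = v i j"

text \<open>
  The labels at the top of the columns outside the image of \<open>\<pi>\<close> are left free: that they vanish
  need not be known, since the transfer matrices do not depend on the row types for any top state.
\<close>

lemma generic_poly_eq_mprod:
  fixes m n :: nat and \<beta> :: "nat \<Rightarrow> row_type" and \<pi> :: "nat \<Rightarrow> nat"
  defines "S \<equiv> {1..n} \<rightarrow>\<^sub>E {0..m}"
  defines "z \<equiv> \<lambda>j\<in>{1..n}. 0"
  assumes "1 \<le> m" "1 \<le> n" and \<pi>: "\<And>k. k \<in> {1..m} \<Longrightarrow> \<pi> k \<in> {1..n}"
  shows "generic_poly m n \<beta> \<pi> = (\<Sum>t | t \<in> S \<and> (\<forall>k\<in>{1..m}. t (\<pi> k) = k).
    mprod S (map (row_matrix {0..m} n) (map (\<lambda>i. (\<beta> i, pipe_number m \<beta> i)) [1..<Suc m])) t z)"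
    (is "_ = (\<Sum>t | ?top t. ?Z t)")
proof -
  let ?\<phi> = "pipe_number m \<beta>"
  \<comment> \<open>\<open>h i\<close> is the state on the edges below row \<open>i\<close>:
    \<open>h 0\<close> is the top state, and \<open>h m = z\<close> says that no pipe crosses the
    South boundary.\<close>
  define H where "H = {h \<in> {0..m} \<rightarrow>\<^sub>E S. (\<forall>k\<in>{1..m}. h 0 (\<pi> k) = k) \<and> h m = z}"
  define V where "V i = {v \<in> {0..n} \<rightarrow>\<^sub>E {0..m}. v 0 = west_label (\<beta> i) (?\<phi> i) \<and> v n = east_label (\<beta> i) (?\<phi> i)}" for i
  define A where "A h v = (\<lambda>(i, j). {T. T \<in> allowed_tiles (\<beta> i) \<and> fits T (\<lambda>s. edge_label h v (cell_edge i j s))})" for h v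
  let ?grid = "{1..m} \<times> {1..n}"
  have finS: "finite S"
    unfolding S_def by (intro finite_PiE) auto
  have zS: "z \<in> S"
    by (auto simp: S_def z_def)
  have finV: "finite (V i)" for i
  proof (rule finite_subset)
    show "V i \<subseteq> {0..n} \<rightarrow>\<^sub>E {0..m}" by (auto simp: V_def)
  qed (intro finite_PiE, auto)
  have finA: "finite (A h v c)" for h v c
  proof (rule finite_subset)
    show "A h v c \<subseteq> allowed_tiles (\<beta> (fst c))" by (auto simp: A_def split: prod.splits)
    show "finite (allowed_tiles (\<beta> (fst c)))"
      by (cases "\<beta> (fst c)") (auto simp: allowed_tiles_def straight_tiles_def)
  qed
  have finH: "finite H"
  proof (rule finite_subset)
    show "H \<subseteq> {0..m} \<rightarrow>\<^sub>E S" by (auto simp: H_def)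
    show "finite ({0..m} \<rightarrow>\<^sub>E S)" using finS by (intro finite_PiE) auto
  qed
  have \<phi>: "?\<phi> i \<in> {0..m}" if "i \<in> {1..m}" for i
    using bij_betwE[OF bij_betw_pipe_number] that by force
  have row: "row_matrix {0..m} n (\<beta> i, ?\<phi> i) t s =
      (\<Sum>v\<in>V i. \<Prod>j\<in>{1..n}. cell_matrix (\<beta> i) (?\<phi> i) j (s j) (t j) (v (j - 1)) (v j))"
    if "i \<in> {1..m}" for i t s
    unfolding row_matrix_def prod.case V_def
    using \<phi>[OF that] by (subst mprod_upt) (cases "\<beta> i"; simp)+
  have cell: "cell_matrix (\<beta> i) (?\<phi> i) j (h i j) (h (i - 1) j) (v i (j - 1)) (v i j) =
      (\<Sum>T\<in>A h v (i, j). tile_weight m \<beta> i j T)" for h v i j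
    using sum_fitting_tiles[where \<beta> = \<beta> and i = i and m = m and j = j and f = "\<lambda>s. edge_label h v (cell_edge i j s)"] by (simp add: A_def)
  have "(\<Sum>t | ?top t. ?Z t) = (\<Sum>t | ?top t. \<Sum>h\<in>{h \<in> H. h 0 = t}.
      \<Prod>i\<in>{1..m}. row_matrix {0..m} n (\<beta> i, ?\<phi> i) (h (i - 1)) (h i))"
  proof (rule sum.cong[OF refl])
    fix t assume "t \<in> {t. ?top t}"
    then have eq: "{h. h \<in> {0..m} \<rightarrow>\<^sub>E S \<and> h 0 = t \<and> h m = z} = {h \<in> H. h 0 = t}" and tS: "t \<in> S"
      by (auto simp: H_def)
    then show "?Z t = (\<Sum>h\<in>{h \<in> H. h 0 = t}.
        \<Prod>i\<in>{1..m}. row_matrix {0..m} n (\<beta> i, ?\<phi> i) (h (i - 1)) (h i))"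
      by (simp only: map_map o_def mprod_upt[OF finS tS zS] eq)
  qed
  \<comment> \<open>The top state is the value \<open>h 0\<close>, so summing over it merely
    regroups \<open>H\<close>.\<close>
  also have "\<dots> = (\<Sum>h\<in>H. \<Prod>i\<in>{1..m}. row_matrix {0..m} n (\<beta> i, ?\<phi> i) (h (i - 1)) (h i))"
  proof (rule sum.group[OF finH])
    show "finite {t. ?top t}" using finS by simp
    show "(\<lambda>h. h 0) ` H \<subseteq> {t. ?top t}" by (auto simp: H_def)
  qed
  also have "\<dots> = (\<Sum>h\<in>H. \<Sum>v\<in>PiE {1..m} V. \<Sum>D\<in>PiE ?grid (A h v). weight m n \<beta> D)"
  proof (rule sum.cong[OF refl])
    fix h
    have "(\<Prod>i\<in>{1..m}. row_matrix {0..m} n (\<beta> i, ?\<phi> i) (h (i - 1)) (h i)) =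
        (\<Prod>i\<in>{1..m}. \<Sum>v\<in>V i. \<Prod>j\<in>{1..n}.
          cell_matrix (\<beta> i) (?\<phi> i) j (h i j) (h (i - 1) j) (v (j - 1)) (v j))"
      by (intro prod.cong row) auto
    also have "\<dots> = (\<Sum>v\<in>PiE {1..m} V. \<Prod>i\<in>{1..m}. \<Prod>j\<in>{1..n}.
          cell_matrix (\<beta> i) (?\<phi> i) j (h i j) (h (i - 1) j) (v i (j - 1)) (v i j))"
      using finV by (intro prod_sum_PiE) auto
    also have "\<dots> = (\<Sum>v\<in>PiE {1..m} V. \<Prod>c\<in>?grid. \<Sum>T\<in>A h v c. tile_weight m \<beta> (fst c) (snd c) T)"
      unfolding cell by (simp add: prod.cartesian_product case_prod_unfold)
    also have "\<dots> = (\<Sum>v\<in>PiE {1..m} V. \<Sum>D\<in>PiE ?grid (A h v). weight m n \<beta> D)"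
      using finA by (simp add: prod_sum_PiE weight_def prod.cartesian_product case_prod_unfold)
    finally show "(\<Prod>i\<in>{1..m}. row_matrix {0..m} n (\<beta> i, ?\<phi> i) (h (i - 1)) (h i)) =
        (\<Sum>v\<in>PiE {1..m} V. \<Sum>D\<in>PiE ?grid (A h v). weight m n \<beta> D)" .
  qed
  also have "\<dots> = (\<Sum>p\<in>H \<times> PiE {1..m} V. \<Sum>D\<in>PiE ?grid (A (fst p) (snd p)). weight m n \<beta> D)"
    by (simp add: sum.cartesian_product case_prod_unfold)
  also have "\<dots> = (\<Sum>x\<in>(SIGMA p:H \<times> PiE {1..m} V. PiE ?grid (A (fst p) (snd p))). weight m n \<beta> (snd x))"
    using finH finV finA by (subst sum.Sigma) (auto intro!: finite_PiE simp: case_prod_unfold)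
  also have "\<dots> = (\<Sum>D | D \<in> pipe_dreams m n \<beta> \<and> has_connectivity m n \<beta> D \<pi>. weight m n \<beta> D)"
  proof -
    let ?X = "SIGMA p:H \<times> PiE {1..m} V. PiE ?grid (A (fst p) (snd p))"
    have lab: "labelling m n \<beta> D (edge_label h v)" and D: "D \<in> pipe_dreams m n \<beta>"
      and con: "has_connectivity m n \<beta> D \<pi>"
      if "h \<in> H" "v \<in> PiE {1..m} V" "D \<in> PiE ?grid (A h v)" for h v D
    proof -
      have v: "v i \<in> V i" if "i \<in> {1..m}" for i
        using \<open>v \<in> PiE {1..m} V\<close> that by (rule PiE_mem)
      have Dij: "D (i, j) \<in> A h v (i, j)" if "i \<in> {1..m}" "j \<in> {1..n}" for i j
        using PiE_mem[OF \<open>D \<in> PiE ?grid (A h v)\<close>, of "(i, j)"] that by simp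
      have "h m = z"
        using that by (auto simp: H_def)
      then show lab: "labelling m n \<beta> D (edge_label h v)"
        using v Dij unfolding labelling_def by (auto simp: A_def V_def z_def)
      have "D \<in> (\<Pi>\<^sub>E (i, j) \<in> ?grid. allowed_tiles (\<beta> i))"
        using that(3) by (rule subsetD[OF PiE_mono, rotated]) (auto simp: A_def)
      then show D: "D \<in> pipe_dreams m n \<beta>"
        using labelling_imp_pipe_dream lab assms by blast
      show "has_connectivity m n \<beta> D \<pi>"
        using labelling_connectivity[OF lab D \<open>1 \<le> n\<close>, of \<pi>] \<pi> that(1) by (auto simp: H_def)
    qed
    \<comment> \<open>Forgetting the labels is injective by \<open>labelling_unique\<close> and
      surjective by \<open>labelling_exists\<close>.\<close>
    have "bij_betw snd ?X {D. D \<in> pipe_dreams m n \<beta> \<and> has_connectivity m n \<beta> D \<pi>}"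
    proof (rule bij_betw_imageI)
      show "inj_on snd ?X"
      proof (rule inj_onI)
        fix x y assume x: "x \<in> ?X" and y: "y \<in> ?X" and "snd x = snd y"
        obtain h v D h' v' where xy: "x = ((h, v), D)" "y = ((h', v'), D)"
          using \<open>snd x = snd y\<close> by (cases x; cases y) auto
        have hv: "h \<in> H" "v \<in> PiE {1..m} V" "D \<in> PiE ?grid (A h v)"
          and hv': "h' \<in> H" "v' \<in> PiE {1..m} V" "D \<in> PiE ?grid (A h' v')"
          using x y xy by auto
        have eq: "edge_label h v (cell_edge i j s) = edge_label h' v' (cell_edge i j s)"
          if "i \<in> {1..m}" "j \<in> {1..n}" for i j s
          using labelling_unique[OF D[OF hv] \<open>1 \<le> n\<close> lab[OF hv] lab[OF hv'] that] .
        \<comment> \<open>South sides give the states below rows \<open>1\<close> to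
          \<open>m\<close>; the top state has no cell above it and is read from the North sides of
          row \<open>1\<close>. The West boundary in \<open>vij\<close> is treated likewise.\<close>
        have hij: "h i j = h' i j" if "i \<in> {0..m}" "j \<in> {1..n}" for i j
          using eq[of i j South] eq[of 1 j North] that \<open>1 \<le> m\<close> by (cases "i = 0") auto
        have hS: "h \<in> {0..m} \<rightarrow>\<^sub>E S" "h' \<in> {0..m} \<rightarrow>\<^sub>E S"
          using hv(1) hv'(1) by (simp_all add: H_def)
        have "h i = h' i" if i: "i \<in> {0..m}" for i
          using PiE_mem[OF hS(1) i] PiE_mem[OF hS(2) i] hij[OF i] unfolding S_def by (rule PiE_ext)
        then have "h = h'"
          by (rule PiE_ext[OF hS])
        have vij: "v i j = v' i j" if "i \<in> {1..m}" "j \<in> {0..n}" for i j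
          using eq[of i j East] eq[of i 1 West] that \<open>1 \<le> n\<close> by (cases "j = 0") auto
        have vV: "v i \<in> {0..n} \<rightarrow>\<^sub>E {0..m}" "v' i \<in> {0..n} \<rightarrow>\<^sub>E {0..m}" if "i \<in> {1..m}" for i
          using PiE_mem[OF hv(2) that] PiE_mem[OF hv'(2) that] by (simp_all add: V_def)
        have "v i = v' i" if i: "i \<in> {1..m}" for i
          using vV[OF i] vij[OF i] by (rule PiE_ext)
        then have "v = v'"
          by (rule PiE_ext[OF hv(2) hv'(2)])
        with \<open>h = h'\<close> show "x = y"
          by (simp add: xy)
      qed
      show "snd ` ?X = {D. D \<in> pipe_dreams m n \<beta> \<and> has_connectivity m n \<beta> D \<pi>}"
      proof (intro subset_antisym subsetI)
        fix D assume "D \<in> snd ` ?X"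
        then show "D \<in> {D. D \<in> pipe_dreams m n \<beta> \<and> has_connectivity m n \<beta> D \<pi>}"
          using D con by auto
      next
        fix D assume "D \<in> {D. D \<in> pipe_dreams m n \<beta> \<and> has_connectivity m n \<beta> D \<pi>}"
        then have D: "D \<in> pipe_dreams m n \<beta>" and con: "has_connectivity m n \<beta> D \<pi>"
          by auto
        obtain L where L: "labelling m n \<beta> D L" and range: "\<And>e. L e \<in> {0..m}"
          using labelling_exists[OF D \<open>1 \<le> n\<close>] by blast
        define h where "h = (\<lambda>i\<in>{0..m}. \<lambda>j\<in>{1..n}. L (HEdge i j))"
        define v where "v = (\<lambda>i\<in>{1..m}. \<lambda>j\<in>{0..n}. L (VEdge i j))"
        have top: "L (HEdge 0 (\<pi> k)) = k" if "k \<in> {1..m}" for k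
          using labelling_connectivity[OF L D \<open>1 \<le> n\<close>, of \<pi>] \<pi> con that by blast
        have "h \<in> {0..m} \<rightarrow>\<^sub>E S"
          unfolding h_def S_def using range by (intro restrict_PiE_iff[THEN iffD2] ballI) auto
        moreover have "h m = z"
          using L by (auto simp: h_def z_def labelling_def)
        moreover have "h 0 (\<pi> k) = k" if "k \<in> {1..m}" for k
          using top \<pi> that by (simp add: h_def)
        ultimately have "h \<in> H"
          by (simp add: H_def)
        moreover have "v \<in> PiE {1..m} V"
        proof -
          have "v i \<in> V i" if "i \<in> {1..m}" for i
            using L that range by (auto simp: v_def V_def labelling_def)
          then show ?thesis
            by (intro PiE_I) (auto simp: v_def)
        qed
        moreover have "D \<in> PiE ?grid (A h v)"
        proof (rule PiE_I)
          fix c assume "c \<in> ?grid"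
          then obtain i j where c: "c = (i, j)" "i \<in> {1..m}" "j \<in> {1..n}"
            by auto
          have "edge_label h v (cell_edge i j s) = L (cell_edge i j s)" for s
            using c(2,3) by (cases s) (auto simp: h_def v_def)
          moreover have "D (i, j) \<in> allowed_tiles (\<beta> i)"
            using D c by (auto simp: pipe_dreams_def PiE_iff)
          ultimately show "D c \<in> A h v c"
            using L c by (simp add: A_def labelling_def)
        next
          fix c assume "c \<notin> ?grid"
          moreover have "D \<in> (\<Pi>\<^sub>E (i, j) \<in> ?grid. allowed_tiles (\<beta> i))"
            using D by (simp add: pipe_dreams_def)
          ultimately show "D c = undefined"
            by (rule PiE_arb[rotated])
        qed
        ultimately have "((h, v), D) \<in> ?X"
          by auto
        then show "D \<in> snd ` ?X"
          by (rule rev_image_eqI) simp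
      qed
    qed
    from sum.reindex_bij_betw[OF this, of "weight m n \<beta>"] show ?thesis .
  qed
  finally show ?thesis
    by (simp only: generic_poly_def)
qed

theorem theorem3p6:
  fixes m n :: nat and \<pi> :: "nat \<Rightarrow> nat" and \<beta> \<beta>' :: "nat \<Rightarrow> row_type"
  assumes "1 \<le> m" and "m \<le> n"
    and "\<pi> \<in> injections m n"
  shows "generic_poly m n \<beta> \<pi> = generic_poly m n \<beta>' \<pi>"
proof -
  let ?S = "{1..n} \<rightarrow>\<^sub>E {0..m}" and ?z = "\<lambda>j\<in>{1..n}. 0"
  let ?ws = "numbered_rows 0 (replicate m Type_w)"
  \<comment> \<open>The right-hand side is free of \<open>\<gamma>\<close>: the matrix elements
    agree for each top state separately.\<close>
  have "generic_poly m n \<gamma> \<pi> = (\<Sum>t | t \<in> ?S \<and> (\<forall>k\<in>{1..m}. t (\<pi> k) = k).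
      mprod ?S (map (row_matrix {0..m} n) ?ws) t ?z)" for \<gamma>
  proof -
    have "mprod ?S (map (row_matrix {0..m} n) (map (\<lambda>i. (\<gamma> i, pipe_number m \<gamma> i)) [1..<Suc m])) t ?z =
        mprod ?S (map (row_matrix {0..m} n) ?ws) t ?z" if "t \<in> ?S" for t
      unfolding numbered_rows_eq_pipe_number[symmetric]
      using mprod_numbered_rows[of "{0..m}" 0 "map \<gamma> [1..<Suc m]" ?z n t] that
      by (simp del: upt_Suc)
    moreover have "\<pi> k \<in> {1..n}" if "k \<in> {1..m}" for k
      using assms(3) that by (auto simp: injections_def PiE_iff)
    ultimately show ?thesis
      using assms(1,2) by (subst generic_poly_eq_mprod) (auto intro!: sum.cong)
  qed
  then show ?thesis
    by simp
qed

end
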